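(* Let $\omega:\mathbb T\to\mathbb R$ be a non-constant real-valued function with $\omega\in L^1(\mathbb T)$ and $\gamma_1=\operatorname{ess\,inf}\omega>-\infty$; put $\gamma_2=\operatorname{ess\,sup}\omega\le+\infty$. Suppose that for some point $\lambda\in(\gamma_1,\gamma_2)$ one has $\ln|\omega(\cdot)-\lambda|\in L^1(\mathbb T)$ and that the set $\Gamma(\lambda)=\{\zeta\in\mathbb T:\omega(\zeta)<\lambda\}$ is (up to a set of measure zero) a union of finitely many open arcs with pairwise disjoint closures, $\Gamma(\lambda)=\bigcup_{j=1}^m(\alpha_j(\lambda),\beta_j(\lambda))$, $m<\infty$. Define, for $j=1,\dots,m$, $$\varphi_j(z;\lambda)=\rho_j(\lambda)\,\xi(z;\lambda)\,\big(1-z\overline{\beta_j(\lambda)}\big)^{-1}\prod_{l=1}^m\big(1-z\overline{\alpha_l(\lambda)}\big)^{-1/2}\big(1-z\overline{\beta_l(\lambda)}\big)^{1/2},\quad |z|<1,$$ $$\varphi_j^{(\mathrm{ext})}(z;\lambda)=\rho_j(\lambda)\,e^{-\pi i\,\mathbf m(\Gamma(\lambda))}\,\xi(z;\lambda)\,\big(1-z\overline{\beta_j(\lambda)}\big)^{-1}\prod_{l=1}^m\big(1-\alpha_l(\lambda)/z\big)^{-1/2}\big(1-\beta_l(\lambda)/z\big)^{1/2},\quad|z|>1.$$ Then for all $j=1,\dots,m$ the equality $$(\omega(\zeta)-\lambda)\,\varphi_j(\zeta_+;\lambda)=\varphi_j^{(\mathrm{ext})}(\zeta_-;\lambda)$$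 is satisfied for a.e. $\zeta\in\mathbb T$.
   Context: $\mathbb D$ is the open unit disk, $\mathbb T$ the unit circle with normalized Lebesgue measure $d\mathbf m(\zeta)=(2\pi i\zeta)^{-1}d\zeta$; $(\zeta_1,\zeta_2)\subset\mathbb T$ denotes the open arc joining $\zeta_1$ to $\zeta_2$ counterclockwise. $H(z)=\frac{1+z}{1-z}$. For $z\in\mathbb C\setminus\mathbb T$, $$\xi(z;\lambda)=\exp\Big(-\frac12\int_{\mathbb T}\ln|\omega(\zeta)-\lambda|\,H(z\overline\zeta)\,d\mathbf m(\zeta)\Big).$$ The positive numbers $\rho_j$ are $\rho_j=\sqrt{c_j}$ with $c_j=\frac1{2\pi}\big(\prod_{l=1}^m|\beta_j-\alpha_l|\big)\big(\prod_{l\ne j}|\beta_j-\beta_l|^{-1}\big)$. Powers $(1+w)^{\pm1/2}$, $w\in\mathbb D$, use the branch of $\ln(1+w)$ analytic in $\mathbb D$ with $\ln1=0$. For a function $\varphi$ on $\mathbb D$, $\varphi(\zeta_+)=\lim_{r\to1-0}\varphi(r\zeta)$; for a function $\varphi^{(\mathrm{ext})}$ on $\{|z|>1\}$, $\varphi^{(\mathrm{ext})}(\zeta_-)=\lim_{r\to1+0}\varphi^{(\mathrm{ext})}(r\zeta)$ (radial limits, existing for a.e. $\zeta\in\mathbb T$ for the functions above). *)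

theory Defs
  imports "HOL-Probability.Probability"
begin

text \<open>
  Normalized Lebesgue measure on the unit circle: with \<open>\<zeta> = exp (2 \<pi> i t)\<close> one has
  \<open>d\<zeta> / (2 \<pi> i \<zeta>) = dt\<close>. It is completed, so that the measurable functions are the
  Lebesgue measurable ones and only values on the circle matter.
\<close>

definition circle_measure :: "complex measure" where
  "circle_measure =
     completion (distr (restrict_space lborel {0..<1}) (restrict_space borel (sphere 0 1))
       (\<lambda>t. cis (2 * pi * t)))"

definition essinf :: "'a measure \<Rightarrow> ('a \<Rightarrow> ereal) \<Rightarrow> ereal" where
  "essinf M f = - esssup M (\<lambda>x. - f x)"

text \<open>For \<open>a \<noteq> b\<close> on the unit circle, the open arc from \<open>a\<close> to \<open>b\<close>, counterclockwise.\<close>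

definition open_arc :: "complex \<Rightarrow> complex \<Rightarrow> complex set" where
  "open_arc a b = {a * cis \<theta> | \<theta>. 0 < \<theta> \<and> \<theta> < Arg2pi (b / a)}"

definition sublevel :: "(complex \<Rightarrow> real) \<Rightarrow> real \<Rightarrow> complex set" where
  "sublevel \<omega> lam = {\<zeta> \<in> sphere 0 1. \<omega> \<zeta> < lam}"

text \<open>
  Integrability of \<open>ln \<bar>\<omega> - lam\<bar>\<close>, where \<open>ln 0 = -\<infinity>\<close>. Since \<^term>\<open>ln (0::real) = 0\<close> in HOL,
  the first conjunct has to be stated separately.
\<close>

definition log_dist_integrable :: "(complex \<Rightarrow> real) \<Rightarrow> real \<Rightarrow> bool" where
  "log_dist_integrable \<omega> lam \<longleftrightarrow>
     (AE \<zeta> in circle_measure. \<omega> \<zeta> \<noteq> lam) \<and>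
     integrable circle_measure (\<lambda>\<zeta>. ln \<bar>\<omega> \<zeta> - lam\<bar>)"

definition herglotz_kernel :: "complex \<Rightarrow> complex" where
  "herglotz_kernel z = (1 + z) / (1 - z)"

definition xi :: "(complex \<Rightarrow> real) \<Rightarrow> real \<Rightarrow> complex \<Rightarrow> complex" where
  "xi \<omega> lam z =
     exp (- (1 / 2) * (LINT \<zeta>|circle_measure.
       complex_of_real (ln \<bar>\<omega> \<zeta> - lam\<bar>) * herglotz_kernel (z * cnj \<zeta>)))"

definition rho :: "nat \<Rightarrow> (nat \<Rightarrow> complex) \<Rightarrow> (nat \<Rightarrow> complex) \<Rightarrow> nat \<Rightarrow> real" where
  "rho m \<alpha> \<beta> j =
     sqrt (1 / (2 * pi) * (\<Prod>l = 1..m. norm (\<beta> j - \<alpha> l)) *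
       (\<Prod>l \<in> {1..m} - {j}. inverse (norm (\<beta> j - \<beta> l))))"

text \<open>
  Every base of a power below is of the form \<open>1 + w\<close> with \<open>\<bar>w\<bar> < 1\<close>, where the principal
  logarithm underlying \<open>powr\<close> is the analytic branch vanishing at \<open>1\<close>.
\<close>

definition phi ::
  "(complex \<Rightarrow> real) \<Rightarrow> real \<Rightarrow> nat \<Rightarrow> (nat \<Rightarrow> complex) \<Rightarrow> (nat \<Rightarrow> complex) \<Rightarrow> nat \<Rightarrow> complex \<Rightarrow> complex"
where
  "phi \<omega> lam m \<alpha> \<beta> j z =
     complex_of_real (rho m \<alpha> \<beta> j) * xi \<omega> lam z * inverse (1 - z * cnj (\<beta> j)) *
     (\<Prod>l = 1..m. (1 - z * cnj (\<alpha> l)) powr (- (1 / 2)) * (1 - z * cnj (\<beta> l)) powr (1 / 2))"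

definition phi_ext ::
  "(complex \<Rightarrow> real) \<Rightarrow> real \<Rightarrow> nat \<Rightarrow> (nat \<Rightarrow> complex) \<Rightarrow> (nat \<Rightarrow> complex) \<Rightarrow> nat \<Rightarrow> complex \<Rightarrow> complex"
where
  "phi_ext \<omega> lam m \<alpha> \<beta> j z =
     complex_of_real (rho m \<alpha> \<beta> j) *
     exp (- (pi * \<i> * complex_of_real (measure circle_measure (sublevel \<omega> lam)))) *
     xi \<omega> lam z * inverse (1 - z * cnj (\<beta> j)) *
     (\<Prod>l = 1..m. (1 - \<alpha> l / z) powr (- (1 / 2)) * (1 - \<beta> l / z) powr (1 / 2))"

definition has_inner_radial_limit :: "(complex \<Rightarrow> complex) \<Rightarrow> complex \<Rightarrow> complex \<Rightarrow> bool" where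
  "has_inner_radial_limit f \<zeta> v \<longleftrightarrow> ((\<lambda>r. f (complex_of_real r * \<zeta>)) \<longlongrightarrow> v) (at_left 1)"

definition has_outer_radial_limit :: "(complex \<Rightarrow> complex) \<Rightarrow> complex \<Rightarrow> complex \<Rightarrow> bool" where
  "has_outer_radial_limit f \<zeta> v \<longleftrightarrow> ((\<lambda>r. f (complex_of_real r * \<zeta>)) \<longlongrightarrow> v) (at_right 1)"

end

theory Submission
  imports Defs "HOL-Complex_Analysis.Complex_Analysis"
begin

text \<open>
  Let \<open>F\<close> be the Herglotz integral of \<open>ln \<bar>\<omega> - lam\<bar>\<close>, so that \<open>\<xi> = exp (- F / 2)\<close>. Reflection in the
  circle gives \<open>F (1 / cnj z) = - cnj (F z)\<close>; if \<open>\<xi>\<close> has the inner radial limit \<open>w \<noteq> 0\<close> at \<open>\<zeta>\<close>, its outer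
  one is \<open>1 / cnj w\<close>, and \<open>\<bar>w\<bar>\<^sup>2 = 1 / \<bar>\<omega> - lam\<bar>\<close> by Fatou's theorem for \<open>Re F\<close>. The quotient of the
  outer and inner branch factors of an arc is \<open>exp (\<i> \<pi> m)\<close>, where \<open>m\<close> is the measure of the arc, off
  the arc and the negative of this on it, which supplies the sign of \<open>\<omega> - lam\<close>.

  The conjugate function is avoided in proving that \<open>w\<close> exists. Splitting the density into positive
  and negative parts writes \<open>\<xi>\<close> as a quotient of two functions \<open>exp (- F / 2)\<close> with \<open>Re F \<ge> 0\<close>, which
  are holomorphic and bounded by \<open>1\<close>. For such a function the tails of the power series have small
  \<open>L\<^sup>2\<close> norm, and a weak type bound for their radial maximal function (Poisson kernel plus Vitali
  covering) gives convergence almost everywhere. That \<open>Re F\<close> tends to the density then follows for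
  bounded densities by integrating over half-lines, and in general by truncation and Fatou's lemma.
\<close>

section \<open>Trigonometric series and the Poisson kernel\<close>

text \<open>Possible zeros of the radial limit shape the argument. Taking \<open>ln\<close> of its
  modulus, or dividing by it, requires that it not vanish. For a density between 0 and N the lower
  bound exp (-N) settles this. For an unbounded density no such bound exists, so the
  \<open>liminf\<close> of the Poisson integrals, a priori possibly infinite, is identified before
  their limit is known to exist. Half-lines suffice in the bounded case because existence of the
  limit is already available: only its identity remains, and Fubini moves the Poisson kernel onto
  the indicator of a half-line, where convergence off the endpoint is elementary. The maximal
  estimate is therefore made for power series on circles of radius R < 1, with constants independent
  of R. It is a bound for squares: the modulus of the series is controlled by the Poisson integral
  of its square, and Parseval supplies the total mass. Points of the circle are written
  \<open>circ t\<close>, so that covering and integration take place on the real line.\<close>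

abbreviation circ :: "real \<Rightarrow> complex" where
  "circ t \<equiv> cis (2 * pi * t)"

lemma continuous_on_circ [continuous_intros]:
  "continuous_on A f \<Longrightarrow> continuous_on A (\<lambda>x. circ (f x))"
  by (intro continuous_intros)

lemma circ_period: "circ (t + 1) = circ t"
  by (simp add: distrib_left flip: cis_mult)

text \<open>For k \<noteq> 0 the antiderivative has period 1, so its increment over a period
  vanishes. The left endpoint c stays free because later integrals run over \<open>{0..1}\<close>,
  \<open>{-1/2..1/2}\<close> and shifted intervals.\<close>

lemma has_integral_cis_int:
  fixes k :: int and c :: real
  shows "((\<lambda>t. cis (2 * pi * (k * t))) has_integral (if k = 0 then 1 else 0)) {c..c+1}"
proof (cases "k = 0")
  case True
  then show ?thesis
    using has_integral_const_real[of "1::complex" c "c+1"] by simp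
next
  case False
  let ?F = "\<lambda>t::real. cis (2 * pi * (k * t)) / (2 * pi * \<i> * k)"
  have "((\<lambda>t. cis (2 * pi * (k * t))) has_integral (?F (c+1) - ?F c)) {c..c+1}"
  proof (rule fundamental_theorem_of_calculus)
    fix x assume "x \<in> {c..c+1}"
    have "((\<lambda>z. exp (\<i> * (2 * pi * (k * z))) / (2 * pi * \<i> * k)) has_field_derivative
             exp (\<i> * (2 * pi * (k * of_real x)))) (at (of_real x))"
      using False by (auto intro!: derivative_eq_intros simp: field_simps)
    from has_vector_derivative_real_field[OF this]
    show "(?F has_vector_derivative cis (2 * pi * (k * x))) (at x within {c..c+1})"
      by (simp add: cis_conv_exp o_def has_vector_derivative_at_within mult_ac)
  qed auto
  moreover have "?F (c+1) = ?F c"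
    by (simp add: distrib_left flip: cis_mult)
  ultimately show ?thesis using False by simp
qed

lemma integral_circ_power:
  "integral {c..c+1} (\<lambda>t. circ t ^ n * circ t ^ m) = (if n + m = 0 then 1 else 0)" (is ?A)
  "integral {c..c+1} (\<lambda>t. circ t ^ n * cnj (circ t ^ m)) = (if n = m then 1 else 0)" (is ?B)
proof -
  have "circ t ^ n * circ t ^ m = cis (2 * pi * (of_int (int n + int m) * t))" for t
    by (simp add: Complex.DeMoivre cis_mult algebra_simps)
  then show ?A
    using has_integral_cis_int[of "int n + int m" c]
    by (simp add: integral_unique del: of_int_add)
  have "circ t ^ n * cnj (circ t ^ m) = cis (2 * pi * (of_int (int n - int m) * t))" for t
    by (simp add: Complex.DeMoivre cis_mult cis_cnj algebra_simps)
  then show ?B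
    using has_integral_cis_int[of "int n - int m" c]
    by (simp add: integral_unique del: of_int_diff)
qed

text \<open>A one-sided Fourier series. In the main use the coefficients are a_n R^n with R < 1: a
  power series restricted to a circle inside the disk, hence absolutely convergent.\<close>

definition trig_series :: "(nat \<Rightarrow> complex) \<Rightarrow> real \<Rightarrow> complex" where
  "trig_series b t = (\<Sum>n. b n * circ t ^ n)"

lemma trig_series_sums:
  assumes "summable (\<lambda>n. norm (b n))"
  shows "(\<lambda>n. b n * circ t ^ n) sums trig_series b t"
proof -
  have "summable (\<lambda>n. norm (b n * circ t ^ n))"
    using assms by (simp add: norm_mult norm_power)
  then show ?thesis
    unfolding trig_series_def by (rule summable_norm_cancel[THEN summable_sums])
qed

lemma uniform_limit_trig_series:
  assumes "summable (\<lambda>n. norm (b n))"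
  shows "uniform_limit A (\<lambda>N t. \<Sum>n<N. b n * circ t ^ n) (trig_series b) sequentially"
  unfolding trig_series_def
  by (rule Weierstrass_m_test[OF _ assms]) (simp add: norm_mult norm_power)

lemma continuous_on_trig_series:
  assumes "summable (\<lambda>n. norm (b n))"
  shows "continuous_on A (trig_series b)"
  by (rule uniform_limit_theorem[OF _ uniform_limit_trig_series[OF assms]])
     (auto intro!: always_eventually continuous_intros)

text \<open>The partial sums converge uniformly, and so do their products with the bounded function
  \<open>B\<close>. Powers of \<open>circ\<close> or a conjugate series in place of \<open>B\<close>
  give the coefficient formulas and Parseval's identity.\<close>

lemma integral_trig_series_mult_sums:
  assumes b: "summable (\<lambda>n. norm (b n))" and B: "continuous_on {c..d} B"
  shows "(\<lambda>n. b n * integral {c..d} (\<lambda>t. circ t ^ n * B t)) sums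
           integral {c..d} (\<lambda>t. trig_series b t * B t)"
proof -
  have bdd: "bounded (B ` {c..d})"
    using compact_continuous_image[OF B] compact_imp_bounded by auto
  have bdd2: "bounded (trig_series b ` {c..d})"
    using compact_continuous_image[OF continuous_on_trig_series[OF b]] compact_imp_bounded by auto
  have ul: "uniform_limit {c..d} (\<lambda>N t. (\<Sum>n<N. b n * circ t ^ n) * B t)
              (\<lambda>t. trig_series b t * B t) sequentially"
    by (intro uniform_lim_mult uniform_limit_trig_series b uniform_limit_const bdd bdd2)
  have cont: "\<And>N. continuous_on {c..d} (\<lambda>t. (\<Sum>n<N. b n * circ t ^ n) * B t)"
    by (intro continuous_intros B)
  obtain I J where IJ: "\<And>N. ((\<lambda>t. (\<Sum>n<N. b n * circ t ^ n) * B t) has_integral I N) {c..d}"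
      "((\<lambda>t. trig_series b t * B t) has_integral J) {c..d}" "I \<longlonglongrightarrow> J"
    using uniform_limit_integral[OF ul cont] by (auto simp: trivial_limit_sequentially)
  have I: "I N = (\<Sum>n<N. b n * integral {c..d} (\<lambda>t. circ t ^ n * B t))" for N
  proof -
    have "I N = integral {c..d} (\<lambda>t. \<Sum>n<N. b n * (circ t ^ n * B t))"
      using IJ(1)[of N] by (simp add: integral_unique sum_distrib_right mult.assoc)
    also have "\<dots> = (\<Sum>n<N. integral {c..d} (\<lambda>t. b n * (circ t ^ n * B t)))"
      by (rule integral_sum) (auto intro!: integrable_continuous_interval continuous_intros B)
    finally show ?thesis by simp
  qed
  then show ?thesis
    using IJ(3) unfolding sums_def integral_unique[OF IJ(2)] by (simp flip: I)
qed

text \<open>Since negative frequencies are absent, multiplying by a power of \<open>circ\<close>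
  leaves at most the constant term, whereas a conjugate power extracts a coefficient. This asymmetry
  yields the Poisson formula.\<close>

lemma integral_trig_series_mult_circ_power:
  assumes "summable (\<lambda>n. norm (b n))"
  shows "integral {c..c+1} (\<lambda>t. trig_series b t * circ t ^ m) = (if m = 0 then b 0 else 0)"
    and "integral {c..c+1} (\<lambda>t. trig_series b t * cnj (circ t ^ m)) = b m"
proof -
  have "(\<lambda>n. b n * integral {c..c+1} (\<lambda>t. circ t ^ n * circ t ^ m)) sums
          integral {c..c+1} (\<lambda>t. trig_series b t * circ t ^ m)"
    by (intro integral_trig_series_mult_sums assms continuous_intros)
  moreover have "(\<lambda>n. b n * (if n + m = 0 then 1 else 0)) sums (if m = 0 then b 0 else 0)"
    using sums_single[of 0 "\<lambda>n. if m = 0 then b 0 else 0"] by (rule sums_cong[THEN iffD1, rotated]) auto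
  ultimately show "integral {c..c+1} (\<lambda>t. trig_series b t * circ t ^ m) = (if m = 0 then b 0 else 0)"
    by (simp only: integral_circ_power sums_unique2)
  have "(\<lambda>n. b n * integral {c..c+1} (\<lambda>t. circ t ^ n * cnj (circ t ^ m))) sums
          integral {c..c+1} (\<lambda>t. trig_series b t * cnj (circ t ^ m))"
    by (intro integral_trig_series_mult_sums assms continuous_intros)
  moreover have "(\<lambda>n. b n * (if n = m then 1 else 0)) sums b m"
    using sums_single[of m b] by (rule sums_cong[THEN iffD1, rotated]) auto
  ultimately show "integral {c..c+1} (\<lambda>t. trig_series b t * cnj (circ t ^ m)) = b m"
    by (simp only: integral_circ_power sums_unique2)
qed

lemma integral_cnj_mult_circ_power:
  assumes "summable (\<lambda>n. norm (b n))"
  shows "integral {c..c+1} (\<lambda>t. circ t ^ n * cnj (trig_series b t)) = cnj (b n)"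
proof -
  have "continuous_on {c..c+1} (\<lambda>t. trig_series b t * cnj (circ t ^ n))"
    by (intro continuous_intros continuous_on_trig_series assms)
  from integrable_integral[OF integrable_continuous_interval[OF this]]
  have "((\<lambda>t. trig_series b t * cnj (circ t ^ n)) has_integral b n) {c..c+1}"
    unfolding integral_trig_series_mult_circ_power(2)[OF assms, of c n] .
  from has_integral_linear[OF this bounded_linear_cnj] show ?thesis
    by (simp add: o_def integral_unique mult.commute)
qed

lemma parseval_trig_series:
  assumes "summable (\<lambda>n. norm (b n))"
  shows "(\<lambda>n. (norm (b n))\<^sup>2) sums integral {c..c+1} (\<lambda>t. (norm (trig_series b t))\<^sup>2)"
proof -
  have "(\<lambda>n. b n * cnj (b n)) sums integral {c..c+1} (\<lambda>t. trig_series b t * cnj (trig_series b t))"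
    using integral_trig_series_mult_sums[OF assms, of c "c+1" "\<lambda>t. cnj (trig_series b t)"]
    by (simp add: integral_cnj_mult_circ_power[OF assms] continuous_on_trig_series[OF assms] continuous_on_cnj)
  also have "integral {c..c+1} (\<lambda>t. trig_series b t * cnj (trig_series b t)) =
      of_real (integral {c..c+1} (\<lambda>t. (norm (trig_series b t))\<^sup>2))"
  proof (rule integral_unique)
    have "((\<lambda>t. (norm (trig_series b t))\<^sup>2) has_integral
             integral {c..c+1} (\<lambda>t. (norm (trig_series b t))\<^sup>2)) {c..c+1}"
      by (intro integrable_integral integrable_continuous_interval continuous_intros
            continuous_on_trig_series assms)
    from has_integral_linear[OF this bounded_linear_of_real[where 'a=complex]]
    show "((\<lambda>t. trig_series b t * cnj (trig_series b t)) has_integral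
        of_real (integral {c..c+1} (\<lambda>t. (norm (trig_series b t))\<^sup>2))) {c..c+1}"
      by (simp add: o_def flip: complex_norm_square)
  qed
  finally have "(\<lambda>n. of_real ((norm (b n))\<^sup>2) :: complex) sums
      of_real (integral {c..c+1} (\<lambda>t. (norm (trig_series b t))\<^sup>2))"
    by (simp flip: complex_norm_square)
  then show ?thesis by (simp only: sums_of_real_iff)
qed

section \<open>The Poisson kernel and its reproducing formula\<close>

definition poisson_kernel :: "complex \<Rightarrow> real" where
  "poisson_kernel w = Re (herglotz_kernel w)"

text \<open>(1 + w) / (1 - w) = 2 / (1 - w) - 1, so the geometric series is doubled and only its
  constant term is corrected.\<close>

lemma herglotz_kernel_sums:
  assumes "norm w < 1"
  shows "(\<lambda>n. (if n = 0 then 1 else 2) * w ^ n) sums herglotz_kernel w"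
proof -
  have nz: "1 - w \<noteq> 0" using assms by auto
  have "(\<lambda>n. 2 * w ^ n - (if n = 0 then 1 else 0)) sums (2 * (1 / (1 - w)) - 1)"
    by (intro sums_diff sums_mult geometric_sums assms) (use sums_single[of 0 "\<lambda>_. 1"] in simp)
  also have "2 * (1 / (1 - w)) - 1 = herglotz_kernel w"
    using nz by (simp add: herglotz_kernel_def field_simps)
  finally show ?thesis by (rule sums_cong[THEN iffD1, rotated]) auto
qed

lemma poisson_kernel_eq:
  "poisson_kernel w = (1 - (norm w)\<^sup>2) / (norm (1 - w))\<^sup>2"
proof -
  \<comment> \<open>At w = 1 both sides are 0, because division by zero yields 0.\<close>
  have "herglotz_kernel w = (1 + w) * cnj (1 - w) / of_real ((norm (1 - w))\<^sup>2)"
    unfolding herglotz_kernel_def complex_norm_square by (cases "w = 1") auto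
  then have "poisson_kernel w = Re ((1 + w) * cnj (1 - w)) / (norm (1 - w))\<^sup>2"
    by (simp add: poisson_kernel_def)
  also have "Re ((1 + w) * cnj (1 - w)) = 1 - (norm w)\<^sup>2"
    unfolding cmod_power2 by (simp add: algebra_simps power2_eq_square)
  finally show ?thesis .
qed

lemma poisson_kernel_nonneg: "norm w \<le> 1 \<Longrightarrow> 0 \<le> poisson_kernel w"
  by (simp add: poisson_kernel_eq power_le_one)

lemma poisson_kernel_circ:
  "poisson_kernel (of_real r * circ s) = (1 - r\<^sup>2) / (1 - 2 * r * cos (2 * pi * s) + r\<^sup>2)"
proof -
  have "(norm (1 - of_real r * circ s))\<^sup>2 =
      (1 - r * cos (2 * pi * s))\<^sup>2 + (r * sin (2 * pi * s))\<^sup>2"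
    unfolding cmod_power2 by simp
  also have "\<dots> = 1 - 2 * r * cos (2 * pi * s) +
      r\<^sup>2 * ((sin (2 * pi * s))\<^sup>2 + (cos (2 * pi * s))\<^sup>2)"
    by algebra
  finally show ?thesis
    by (simp add: poisson_kernel_eq norm_mult)
qed

lemma poisson_kernel_even: "poisson_kernel (of_real r * circ (- s)) = poisson_kernel (of_real r * circ s)"
  unfolding poisson_kernel_circ by simp

lemma continuous_on_poisson_kernel_circ:
  assumes "\<bar>r\<bar> < 1"
  shows "continuous_on A (\<lambda>s. poisson_kernel (of_real r * circ s))"
  unfolding poisson_kernel_def herglotz_kernel_def
proof (intro continuous_intros ballI)
  fix s
  have "norm (of_real r * circ s) \<noteq> 1" using assms by (simp add: norm_mult)
  then show "1 - of_real r * circ s \<noteq> 0" by auto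
qed

text \<open>The kernel is half the sum of the Herglotz series and its conjugate. Against
  \<open>circ s ^ n\<close> with n > 0 the first vanishes and the second gives 2 r^n; for n = 0 each
  gives 1. Either way the half sum is r^n.\<close>

lemma poisson_formula_trig_series:
  assumes b: "summable (\<lambda>n. norm (b n))" and r: "0 \<le> r" "r < 1"
  shows "(\<lambda>n. b n * of_real r ^ n) sums
           integral {c..c+1} (\<lambda>s. trig_series b s * of_real (poisson_kernel (of_real r * circ s)))"
proof -
  define h :: "nat \<Rightarrow> complex" where "h n = (if n = 0 then 1 else 2) * of_real r ^ n" for n
  have "summable (\<lambda>n. 2 * r ^ n)" using r by (simp add: summable_mult summable_geometric)
  then have h: "summable (\<lambda>n. norm (h n))"
    by (rule summable_comparison_test') (use r in \<open>auto simp: h_def norm_mult norm_power\<close>)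
  have hs: "trig_series h s = herglotz_kernel (of_real r * circ s)" for s
  proof (rule sums_unique2[OF trig_series_sums[OF h]])
    show "(\<lambda>n. h n * circ s ^ n) sums herglotz_kernel (of_real r * circ s)"
      using herglotz_kernel_sums[of "of_real r * circ s"] r
      by (simp add: h_def norm_mult power_mult_distrib mult.assoc)
  qed
  have P: "of_real (poisson_kernel (of_real r * circ s)) =
      (trig_series h s + cnj (trig_series h s)) / 2" for s
    unfolding hs poisson_kernel_def by (simp add: complex_add_cnj)
  have int: "integral {c..c+1} (\<lambda>s. circ s ^ n * of_real (poisson_kernel (of_real r * circ s)))
      = of_real r ^ n" for n
  proof -
    have "integral {c..c+1} (\<lambda>s. circ s ^ n * of_real (poisson_kernel (of_real r * circ s))) =
       integral {c..c+1} (\<lambda>s. (trig_series h s * circ s ^ n + circ s ^ n * cnj (trig_series h s)) / 2)"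
      unfolding P by (intro integral_cong) algebra
    also have "\<dots> = (integral {c..c+1} (\<lambda>s. trig_series h s * circ s ^ n) +
                     integral {c..c+1} (\<lambda>s. circ s ^ n * cnj (trig_series h s))) / 2"
      by (subst integral_add[symmetric])
         (auto intro!: integrable_continuous_interval continuous_intros continuous_on_trig_series h)
    also have "\<dots> = of_real r ^ n"
      unfolding integral_trig_series_mult_circ_power[OF h] integral_cnj_mult_circ_power[OF h]
      by (auto simp: h_def)
    finally show ?thesis .
  qed
  have "continuous_on {c..c+1} (\<lambda>s. complex_of_real (poisson_kernel (of_real r * circ s)))"
    using r by (intro continuous_intros continuous_on_poisson_kernel_circ) auto
  from integral_trig_series_mult_sums[OF b this] show ?thesis unfolding int .
qed

text \<open>This is the Poisson formula for the series whose only nonzero coefficient is the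
  constant 1.\<close>

lemma integral_poisson_kernel:
  assumes r: "0 \<le> r" "r < 1"
  shows "((\<lambda>s. poisson_kernel (of_real r * circ s)) has_integral 1) {c..c+1}"
proof -
  let ?b = "\<lambda>n::nat. if n = 0 then 1 else 0 :: complex"
  have b: "summable (\<lambda>n. norm (?b n))"
    by (rule summable_finite[of "{0}"]) auto
  have one: "trig_series ?b s = 1" for s
    using sums_unique2[OF trig_series_sums[OF b, of s]] sums_single[of 0 "\<lambda>_. 1::complex"]
    by (metis (mono_tags, lifting) mult_cancel_right1 mult_eq_0_iff power_0 sums_cong)
  have "(\<lambda>n. ?b n * of_real r ^ n) sums 1"
    using sums_single[of 0 "\<lambda>_. 1::complex"] by (rule sums_cong[THEN iffD1, rotated]) auto
  with poisson_formula_trig_series[OF b r, of c]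
  have "integral {c..c+1} (\<lambda>s. complex_of_real (poisson_kernel (of_real r * circ s))) = 1"
    by (simp add: one sums_unique2)
  moreover have "((\<lambda>s. poisson_kernel (of_real r * circ s)) has_integral
        integral {c..c+1} (\<lambda>s. poisson_kernel (of_real r * circ s))) {c..c+1}"
    using r by (intro integrable_integral integrable_continuous_interval continuous_on_poisson_kernel_circ) auto
  moreover from has_integral_linear[OF this bounded_linear_of_real[where 'a=complex]]
  have "integral {c..c+1} (\<lambda>s. complex_of_real (poisson_kernel (of_real r * circ s))) =
      of_real (integral {c..c+1} (\<lambda>s. poisson_kernel (of_real r * circ s)))"
    by (simp add: o_def integral_unique)
  ultimately show ?thesis by (metis of_real_eq_1_iff)
qed

section \<open>The maximal function\<close>

lemma integral_symmetric_interval: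
  fixes k :: "real \<Rightarrow> real"
  assumes k: "continuous_on UNIV k" and c: "0 \<le> c"
  shows "integral {-c..c} k = integral {0..c} (\<lambda>s. k s + k (- s))"
proof -
  have int: "k integrable_on {a..b}" "(\<lambda>s. k (- s)) integrable_on {a..b}" for a b
    by (auto intro!: integrable_continuous_interval continuous_on_compose2[OF k] continuous_intros)
  have "integral {-c..c} k = integral {-c..0} k + integral {0..c} k"
    using c by (intro Henstock_Kurzweil_Integration.integral_combine[symmetric] int) auto
  also have "integral {-c..0} k = integral {0..c} (\<lambda>s. k (- s))"
    using Henstock_Kurzweil_Integration.integral_reflect_real[of c 0 "\<lambda>s. k (- s)"] by simp
  finally show ?thesis
    by (simp add: int Henstock_Kurzweil_Integration.integral_add)
qed

lemma poisson_kernel_antimono: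
  assumes r: "0 \<le> r" "r < 1" and "0 \<le> s" "s \<le> t" "t \<le> 1/2"
  shows "poisson_kernel (of_real r * circ t) \<le> poisson_kernel (of_real r * circ s)"
proof -
  have "cos (2 * pi * t) \<le> cos (2 * pi * s)"
    using assms by (intro cos_monotone_0_pi_le) auto
  then have *: "1 - 2 * r * cos (2 * pi * s) + r\<^sup>2 \<le> 1 - 2 * r * cos (2 * pi * t) + r\<^sup>2"
    using r by (simp add: mult_left_mono)
  have "2 * r * cos (2 * pi * s) \<le> 2 * r"
    using r by (simp add: mult_left_le)
  moreover have "0 < (1 - r)\<^sup>2" using r by simp
  ultimately have "0 < 1 - 2 * r * cos (2 * pi * s) + r\<^sup>2"
    by (simp add: power2_diff)
  then show ?thesis
    unfolding poisson_kernel_circ using * r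
    by (intro divide_left_mono mult_pos_pos) (auto simp: power_le_one)
qed

text \<open>
  On \<open>[0, 1/2]\<close> the kernel decreases, so the second mean value theorem expresses the Poisson
  integral through integrals of \<open>h - M\<close> over symmetric intervals, all of which are at most \<open>0\<close>.
\<close>

lemma poisson_integral_le_maximal:
  fixes h :: "real \<Rightarrow> real"
  assumes h: "continuous_on UNIV h" and r: "0 \<le> r" "r < 1"
    and M: "\<And>s. \<lbrakk>0 < s; s \<le> 1/2\<rbrakk> \<Longrightarrow> integral {x-s..x+s} h \<le> 2 * s * M"
  shows "integral {-1/2..1/2} (\<lambda>s. poisson_kernel (of_real r * circ s) * h (x + s)) \<le> M"
proof -
  define P where "P s = poisson_kernel (of_real r * circ s)" for s
  \<comment> \<open>Twice the even part of h (x + s) - M in s. The kernel is even, so nothing else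
    contributes to the Poisson integral.\<close>
  define \<psi> where "\<psi> s = h (x + s) - M + (h (x - s) - M)" for s
  have P: "continuous_on A P" for A
    unfolding P_def using r by (intro continuous_on_poisson_kernel_circ) auto
  have hx: "continuous_on A (\<lambda>s. h (x + s))" for A
    by (rule continuous_on_compose2[OF h]) (auto intro!: continuous_intros)
  have hx': "continuous_on A (\<lambda>s. h (x - s))" for A
    by (rule continuous_on_compose2[OF h]) (auto intro!: continuous_intros)
  have \<psi>: "continuous_on A \<psi>" for A
    unfolding \<psi>_def by (intro continuous_intros hx hx')
  have \<psi>_le: "integral {0..c} \<psi> \<le> 0" if c: "0 \<le> c" "c \<le> 1/2" for c
  proof -
    have "integral {0..c} \<psi> = integral {-c..c} (\<lambda>s. h (x + s) - M)"
      unfolding \<psi>_def using c by (subst integral_symmetric_interval) (auto intro!: continuous_intros hx)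
    also have "\<dots> = integral {-c..c} (\<lambda>s. h (x + s)) - 2 * c * M"
      using c by (subst Henstock_Kurzweil_Integration.integral_diff)
                 (auto intro!: integrable_continuous_interval hx)
    also have "integral {-c..c} (\<lambda>s. h (x + s)) = integral {x-c..x+c} h"
      using integral_shift_real_ivl[of "x-c" x "x+c" h] by (simp add: add.commute)
    also have "\<dots> \<le> 2 * c * M" using M[of c] c by (cases "c = 0") auto
    finally show ?thesis by simp
  qed
  have "\<psi> integrable_on {0..1/2}" by (intro integrable_continuous_interval \<psi>)
  \<comment> \<open>The second mean value theorem is stated for nondecreasing weights, hence the
    sign.\<close>
  moreover have "- P s \<le> - P t" if "0 \<le> s" "s \<le> t" "t \<le> 1/2" for s t
    using poisson_kernel_antimono[OF r that] by (simp add: P_def)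
  ultimately obtain c where c: "c \<in> {0..1/2}" and
    eq: "integral {0..1/2} (\<lambda>s. - P s * \<psi> s) =
           - P 0 * integral {0..c} \<psi> + - P (1/2) * integral {c..1/2} \<psi>"
    using second_mean_value_theorem[where a=0 and b="1/2" and f=\<psi> and g="\<lambda>s. - P s"] by auto
  have "integral {c..1/2} \<psi> = integral {0..1/2} \<psi> - integral {0..c} \<psi>"
    using c Henstock_Kurzweil_Integration.integral_combine[of 0 c "1/2" \<psi>]
    by (auto intro!: integrable_continuous_interval \<psi> simp: algebra_simps)
  \<comment> \<open>Rearranged so that both integrals start at 0, where \<open>\<psi>_le\<close>
    applies, and both weights are nonnegative.\<close>
  with eq have "integral {0..1/2} (\<lambda>s. P s * \<psi> s) =
      (P 0 - P (1/2)) * integral {0..c} \<psi> + P (1/2) * integral {0..1/2} \<psi>"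
    by (simp add: algebra_simps)
  also have "\<dots> \<le> 0"
  proof -
    have "P (1/2) \<le> P 0" using poisson_kernel_antimono[OF r, of 0 "1/2"] by (simp add: P_def)
    moreover have "0 \<le> P (1/2)" unfolding P_def using r
      by (intro poisson_kernel_nonneg) (simp add: norm_mult)
    ultimately show ?thesis using \<psi>_le[of c] \<psi>_le[of "1/2"] c
      by (intro add_nonpos_nonpos mult_nonneg_nonpos) auto
  qed
  also have "integral {0..1/2} (\<lambda>s. P s * \<psi> s) = integral {-1/2..1/2} (\<lambda>s. P s * (h (x + s) - M))"
  proof -
    have "integral {0..1/2} (\<lambda>s. P s * \<psi> s) =
        integral {0..1/2} (\<lambda>s. P s * (h (x + s) - M) + P (- s) * (h (x + - s) - M))"
      unfolding \<psi>_def P_def poisson_kernel_even by (intro integral_cong) (simp add: algebra_simps)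
    also have "\<dots> = integral {-(1/2)..1/2} (\<lambda>s. P s * (h (x + s) - M))"
      by (subst integral_symmetric_interval) (auto intro!: continuous_intros P hx)
    finally show ?thesis by simp
  qed
  also have "\<dots> = integral {-1/2..1/2} (\<lambda>s. P s * h (x + s)) - integral {-1/2..1/2} (\<lambda>s. P s * M)"
    unfolding right_diff_distrib
    by (intro Henstock_Kurzweil_Integration.integral_diff integrable_continuous_interval continuous_intros P hx)
  also have "integral {-1/2..1/2} (\<lambda>s. P s * M) = M"
    using integral_poisson_kernel[OF r, of "-1/2"] by (simp add: P_def integral_unique)
  finally show ?thesis by (simp add: P_def)
qed

section \<open>Weak type bound from the Vitali covering lemma\<close>

text \<open>Countable subadditivity for an index set that is a countable set of reals rather than a
  sequence, in the same form in which \<open>emeasure_UN_countable\<close> expresses additivity for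
  the disjoint balls.\<close>

lemma emeasure_UN_le_count_space:
  assumes "countable C" "\<And>i. i \<in> C \<Longrightarrow> X i \<in> sets M"
  shows "emeasure M (\<Union>(X ` C)) \<le> (\<integral>\<^sup>+i. emeasure M (X i) \<partial>count_space C)"
proof -
  have "emeasure M (\<Union>(X ` C)) = (\<integral>\<^sup>+x. indicator (\<Union>(X ` C)) x \<partial>M)"
    using assms by (subst nn_integral_indicator) auto
  also have "\<dots> \<le> (\<integral>\<^sup>+x. (\<integral>\<^sup>+i. indicator (X i) x \<partial>count_space C) \<partial>M)"
  proof (intro nn_integral_mono)
    fix x
    show "indicator (\<Union>(X ` C)) x \<le> (\<integral>\<^sup>+i. indicator (X i) x \<partial>count_space C)"
    proof (cases "x \<in> \<Union>(X ` C)")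
      case True
      then obtain i where i: "i \<in> C" "x \<in> X i" by auto
      have "(\<integral>\<^sup>+j. indicator {i} j \<partial>count_space C) \<le> (\<integral>\<^sup>+j. indicator (X j) x \<partial>count_space C)"
        by (intro nn_integral_mono) (use i in \<open>auto simp: indicator_def\<close>)
      then show ?thesis using True i by (simp add: one_ennreal_def[symmetric])
    qed simp
  qed
  also have "\<dots> = (\<integral>\<^sup>+i. (\<integral>\<^sup>+x. indicator (X i) x \<partial>M) \<partial>count_space C)"
    using assms by (intro nn_integral_count_space_nn_integral) auto
  also have "\<dots> = (\<integral>\<^sup>+i. emeasure M (X i) \<partial>count_space C)"
    using assms by (intro nn_integral_cong) auto
  finally show ?thesis .
qed

text \<open>Vitali's lemma selects disjoint balls whose fivefold enlargements cover
  \<open>S\<close>. An enlargement has length 10 R, which is at most 5 / \<tau> times the integral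
  of \<open>h\<close> over the original ball; disjointness lets these integrals be added.
  Measurability of \<open>S\<close> is not at hand, so the bound is given for a Borel cover.\<close>

lemma hardy_littlewood_weak_type:
  fixes h :: "real \<Rightarrow> real"
  assumes h: "continuous_on UNIV h" "\<And>x. 0 \<le> h x" and \<tau>: "0 < \<tau>"
    and S: "S \<subseteq> {0..1}" "\<And>x. x \<in> S \<Longrightarrow> \<exists>s>0. s \<le> 1/2 \<and> 2 * s * \<tau> < integral {x-s..x+s} h"
  shows "\<exists>T\<in>sets borel. S \<subseteq> T \<and> emeasure lborel T \<le> ennreal (5 / \<tau> * integral {-1..2} h)"
proof -
  obtain R where R: "\<And>x. x \<in> S \<Longrightarrow> 0 < R x \<and> R x \<le> 1/2 \<and> 2 * R x * \<tau> < integral {x - R x..x + R x} h"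
    using S(2) by metis
  have "S \<subseteq> (\<Union>x\<in>S. ball x (R x))" using R by force
  then obtain C where C: "countable C" "C \<subseteq> S"
      "pairwise (\<lambda>i j. disjnt (ball i (R i)) (ball j (R j))) C"
      "S \<subseteq> (\<Union>i\<in>C. ball i (5 * R i))"
    by (rule Vitali_covering_lemma_balls[where B="1/2" and r=R]) (use R in auto)
  have h_meas [measurable]: "h \<in> borel_measurable borel"
    by (rule borel_measurable_continuous_onI[OF h(1)])
  define \<mu> where "\<mu> = density lborel (\<lambda>x. ennreal (h x))"
  have \<mu>: "emeasure \<mu> {a..b} = ennreal (integral {a..b} h)" for a b
  proof -
    have "(h has_integral integral {a..b} h) {a..b}"
      by (intro integrable_integral integrable_continuous_interval continuous_on_subset[OF h(1)]) auto
    from nn_integral_has_integral_lebesgue'[OF _ this] show ?thesis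
      by (simp add: \<mu>_def emeasure_density h(2) mult.commute ennreal_mult' flip: ennreal_indicator)
  qed
  \<comment> \<open>Vitali's balls are open while the averages are over closed intervals; the two
    endpoints have no mass.\<close>
  have \<mu>_ball: "emeasure \<mu> (ball a b) = emeasure \<mu> {a-b..a+b}" if "0 < b" for a b
  proof -
    have "emeasure \<mu> {a-b..a+b} = emeasure \<mu> ({a-b<..<a+b} \<union> {a-b, a+b})"
      using that by (intro arg_cong2[where f=emeasure]) auto
    also have "\<dots> = emeasure \<mu> {a-b<..<a+b}"
    proof (rule emeasure_Un_null_set)
      have "{x} \<in> null_sets \<mu>" for x
        using \<mu>[of x x] by (auto simp: \<mu>_def null_sets_def)
      from null_sets.Un[OF this this, of "a - b" "a + b"] show "{a - b, a + b} \<in> null_sets \<mu>"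
        by (simp add: insert_commute)
    qed (simp add: \<mu>_def)
    finally show ?thesis by (simp add: ball_eq_greaterThanLessThan)
  qed
  have "emeasure lborel (\<Union>i\<in>C. ball i (5 * R i)) \<le>
      (\<integral>\<^sup>+i. emeasure lborel (ball i (5 * R i)) \<partial>count_space C)"
    by (intro emeasure_UN_le_count_space C) auto
  also have "\<dots> \<le> (\<integral>\<^sup>+i. ennreal (5 / \<tau>) * emeasure \<mu> (ball i (R i)) \<partial>count_space C)"
  proof (intro nn_integral_mono)
    fix i assume "i \<in> space (count_space C)"
    then have i: "0 < R i" "2 * R i * \<tau> < integral {i - R i..i + R i} h"
      using R C by auto
    then have "10 * R i \<le> 5 / \<tau> * integral {i - R i..i + R i} h"
      using \<tau> by (simp add: field_simps)
    moreover have "emeasure lborel (ball i (5 * R i)) = ennreal (10 * R i)"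
      using i by (simp add: ball_eq_greaterThanLessThan)
    ultimately show "emeasure lborel (ball i (5 * R i)) \<le> ennreal (5 / \<tau>) * emeasure \<mu> (ball i (R i))"
      using i \<tau> by (simp add: \<mu>_ball \<mu> ennreal_leI flip: ennreal_mult')
  qed
  also have "\<dots> = ennreal (5 / \<tau>) * (\<integral>\<^sup>+i. emeasure \<mu> (ball i (R i)) \<partial>count_space C)"
    by (rule nn_integral_cmult) simp
  also have "(\<integral>\<^sup>+i. emeasure \<mu> (ball i (R i)) \<partial>count_space C) = emeasure \<mu> (\<Union>i\<in>C. ball i (R i))"
    using C(1,3) by (intro emeasure_UN_countable[symmetric])
      (auto simp: \<mu>_def disjoint_family_on_def pairwise_def disjnt_def)
  also have "\<dots> \<le> emeasure \<mu> {-1..2}"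
  proof (rule emeasure_mono)
    \<comment> \<open>Centres in [0, 1] and radii at most 1/2 keep the balls inside [-1, 2], which
      consists of three full periods.\<close>
    show "(\<Union>i\<in>C. ball i (R i)) \<subseteq> {-1..2}"
    proof
      fix y assume "y \<in> (\<Union>i\<in>C. ball i (R i))"
      then obtain i where i: "i \<in> S" "dist i y < R i" using C by auto
      then have "R i \<le> 1/2" "0 \<le> i" "i \<le> 1" using R S by auto
      with i(2) show "y \<in> {-1..2}" by (auto simp: dist_real_def abs_less_iff)
    qed
  qed (simp add: \<mu>_def)
  finally have "emeasure lborel (\<Union>i\<in>C. ball i (5 * R i)) \<le> ennreal (5 / \<tau> * integral {-1..2} h)"
    using \<tau> by (subst ennreal_mult') (auto simp: \<mu> mult_left_mono)
  moreover have "(\<Union>i\<in>C. ball i (5 * R i)) \<in> sets borel"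
    by (intro borel_open open_UN) auto
  ultimately show ?thesis using C(4) by blast
qed

section \<open>Radial limits of bounded holomorphic functions\<close>

lemma trig_series_rotate:
  assumes "summable (\<lambda>n. norm (b n))"
  shows "trig_series (\<lambda>n. b n * circ x ^ n) s = trig_series b (x + s)"
proof -
  have "(\<lambda>n. b n * circ x ^ n * circ s ^ n) sums trig_series b (x + s)"
    using trig_series_sums[OF assms, of "x + s"]
    by (simp add: distrib_left power_mult_distrib mult.assoc flip: cis_mult)
  moreover have "summable (\<lambda>n. norm (b n * circ x ^ n))"
    using assms by (simp add: norm_mult norm_power)
  from trig_series_sums[OF this]
  have "(\<lambda>n. b n * circ x ^ n * circ s ^ n) sums trig_series (\<lambda>n. b n * circ x ^ n) s" .
  ultimately show ?thesis
    by (simp only: sums_unique2)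
qed

text \<open>Rotation by \<open>circ x\<close> is absorbed into the coefficients, which reduces an
  arbitrary ray to the positive real axis.\<close>

lemma poisson_formula_power_series:
  assumes b: "summable (\<lambda>n. norm (b n))" and r: "0 \<le> r" "r < 1"
  shows "(\<lambda>n. b n * (of_real r * circ x) ^ n) sums
     integral {-1/2..1/2} (\<lambda>s. trig_series b (x + s) * of_real (poisson_kernel (of_real r * circ s)))"
proof -
  have "summable (\<lambda>n. norm (b n * circ x ^ n))"
    using b by (simp add: norm_mult norm_power)
  from poisson_formula_trig_series[OF this r, of "-1/2"]
  have "(\<lambda>n. b n * circ x ^ n * of_real r ^ n) sums
     integral {-1/2..1/2} (\<lambda>s. trig_series b (x + s) * of_real (poisson_kernel (of_real r * circ s)))"
    unfolding trig_series_rotate[OF b] by simp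
  moreover have "b n * circ x ^ n * of_real r ^ n = b n * (of_real r * circ x) ^ n" for n
    by (simp add: power_mult_distrib)
  ultimately show ?thesis by simp
qed

text \<open>The inequality y \<le> \<tau> / 2 + y^2 / (2 \<tau>), averaged against a kernel of mass
  1, replaces Cauchy-Schwarz. The parameter \<tau> will be the level of the maximal function: a
  value above \<tau> then forces the Poisson integral of the square above \<tau>^2.\<close>

lemma norm_power_series_le_poisson_square:
  assumes b: "summable (\<lambda>n. norm (b n))" and r: "0 \<le> r" "r < 1" and \<tau>: "0 < \<tau>"
  shows "norm (\<Sum>n. b n * (of_real r * circ x) ^ n) \<le>
    \<tau> / 2 + integral {-1/2..1/2} (\<lambda>s. poisson_kernel (of_real r * circ s) * (norm (trig_series b (x + s)))\<^sup>2) / (2 * \<tau>)"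
proof -
  define P where "P s = poisson_kernel (of_real r * circ s)" for s
  have P: "continuous_on A P" for A
    unfolding P_def using r by (intro continuous_on_poisson_kernel_circ) auto
  have P0: "0 \<le> P s" for s
    unfolding P_def using r by (intro poisson_kernel_nonneg) (simp add: norm_mult)
  have t: "continuous_on A (\<lambda>s. trig_series b (x + s))" for A
    by (rule continuous_on_compose2[OF continuous_on_trig_series[OF b, of UNIV]]) (auto intro!: continuous_intros)
  have "norm (\<Sum>n. b n * (of_real r * circ x) ^ n) =
      norm (integral {-1/2..1/2} (\<lambda>s. trig_series b (x + s) * of_real (P s)))"
    using poisson_formula_power_series[OF b r, of x] by (simp add: sums_iff P_def)
  also have "\<dots> \<le> integral {-1/2..1/2} (\<lambda>s. \<tau> / 2 * P s + P s * (norm (trig_series b (x + s)))\<^sup>2 / (2 * \<tau>))"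
  proof (intro integral_norm_bound_integral integrable_continuous_interval continuous_intros P t)
    fix s
    define y where "y = norm (trig_series b (x + s))"
    have "0 \<le> (\<tau> - y)\<^sup>2" by simp
    then have "y \<le> \<tau> / 2 + y\<^sup>2 / (2 * \<tau>)"
      using \<tau> by (simp add: field_simps power2_eq_square)
    from mult_right_mono[OF this P0[of s]]
    show "norm (trig_series b (x + s) * of_real (P s)) \<le>
        \<tau> / 2 * P s + P s * (norm (trig_series b (x + s)))\<^sup>2 / (2 * \<tau>)"
      using P0[of s] by (simp add: norm_mult y_def algebra_simps)
  qed (use \<tau> in auto)
  also have "\<dots> = integral {-1/2..1/2} (\<lambda>s. \<tau> / 2 * P s) +
      integral {-1/2..1/2} (\<lambda>s. P s * (norm (trig_series b (x + s)))\<^sup>2 / (2 * \<tau>))"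
    using \<tau> by (intro Henstock_Kurzweil_Integration.integral_add integrable_continuous_interval continuous_intros P t) auto
  also have "\<dots> = \<tau> / 2 + integral {-1/2..1/2} (\<lambda>s. P s * (norm (trig_series b (x + s)))\<^sup>2) / (2 * \<tau>)"
    using integral_poisson_kernel[OF r, of "-1/2"] by (simp add: P_def integral_unique)
  finally show ?thesis by (simp add: P_def)
qed

text \<open>For r below some R < 1 the series is a Poisson integral of its own restriction to the
  circle of radius R, where the coefficients are absolutely summable. The Hardy-Littlewood bound at
  level \<tau>^2 does not depend on R, so R can tend to 1. The constant 15 is the 5 of the covering
  lemma times three periods.\<close>

lemma power_series_maximal_weak_type:
  fixes b :: "nat \<Rightarrow> complex"
  assumes b: "\<And>R. \<lbrakk>0 \<le> R; R < 1\<rbrakk> \<Longrightarrow> summable (\<lambda>n. norm (b n * of_real R ^ n))"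
    and b2: "summable (\<lambda>n. (norm (b n))\<^sup>2)" and \<tau>: "0 < \<tau>"
  defines "S \<equiv> {x\<in>{0..1}. \<exists>r\<in>{0..<1}. \<tau> < norm (\<Sum>n. b n * (of_real r * circ x) ^ n)}"
  shows "S \<in> sets borel" and "emeasure lborel S \<le> ennreal (15 / \<tau>\<^sup>2 * (\<Sum>n. (norm (b n))\<^sup>2))"
proof -
  let ?G = "\<lambda>r x. \<Sum>n. b n * (of_real r * circ x) ^ n"
  have G: "?G r x = trig_series (\<lambda>n. b n * of_real r ^ n) x" for r x
    by (simp add: trig_series_def power_mult_distrib mult_ac)
  define SR where "SR R = {x\<in>{0..1}. \<exists>r\<in>{0..<R}. \<tau> < norm (?G r x)}" for R :: real
  have meas: "SR R \<in> sets borel" if "R \<le> 1" for R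
  proof -
    \<comment> \<open>The union over r is uncountable, but of open sets, so measurability
      survives.\<close>
    have "open (\<Union>r\<in>{0..<R}. {x. \<tau> < norm (?G r x)})"
      unfolding G using that
      by (intro open_UN ballI open_Collect_less continuous_intros continuous_on_trig_series b) auto
    moreover have "SR R = {0..1} \<inter> (\<Union>r\<in>{0..<R}. {x. \<tau> < norm (?G r x)})"
      by (auto simp: SR_def)
    ultimately show ?thesis by auto
  qed
  show "S \<in> sets borel" using meas[of 1] by (simp add: S_def SR_def)
  have bound: "emeasure lborel (SR R) \<le> ennreal (15 / \<tau>\<^sup>2 * (\<Sum>n. (norm (b n))\<^sup>2))" if R: "0 < R" "R < 1" for R
  proof -
    define c where "c n = b n * of_real R ^ n" for n
    have c: "summable (\<lambda>n. norm (c n))" using b[of R] R by (simp add: c_def)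
    define h where "h x = (norm (trig_series c x))\<^sup>2" for x
    have h: "continuous_on A h" for A
      unfolding h_def by (intro continuous_intros continuous_on_trig_series c)
    have h0: "0 \<le> h x" for x by (simp add: h_def)
    have "\<exists>T\<in>sets borel. SR R \<subseteq> T \<and> emeasure lborel T \<le> ennreal (5 / \<tau>\<^sup>2 * integral {-1..2} h)"
    proof (rule hardy_littlewood_weak_type)
      fix x assume "x \<in> SR R"
      then obtain r where r: "0 \<le> r" "r < R" "\<tau> < norm (?G r x)" by (auto simp: SR_def)
      \<comment> \<open>Relative radius: the point at radius r is seen from the circle of radius
        R.\<close>
      define q where "q = r / R"
      have q: "0 \<le> q" "q < 1" using r R by (auto simp: q_def)
      have "?G r x = (\<Sum>n. c n * (of_real q * circ x) ^ n)"
        using R by (simp add: c_def q_def power_mult_distrib power_divide)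
      also have "norm \<dots> \<le> \<tau> / 2 +
          integral {-1/2..1/2} (\<lambda>s. poisson_kernel (of_real q * circ s) * h (x + s)) / (2 * \<tau>)"
        unfolding h_def by (rule norm_power_series_le_poisson_square[OF c q \<tau>])
      finally have "\<tau> / 2 < integral {-1/2..1/2} (\<lambda>s. poisson_kernel (of_real q * circ s) * h (x + s)) / (2 * \<tau>)"
        using r by simp
      then have big: "\<tau>\<^sup>2 < integral {-1/2..1/2} (\<lambda>s. poisson_kernel (of_real q * circ s) * h (x + s))"
        using \<tau> by (simp add: field_simps power2_eq_square)
      \<comment> \<open>If every symmetric average were at most \<tau>^2, the Poisson integral would
        be as well.\<close>
      show "\<exists>s>0. s \<le> 1/2 \<and> 2 * s * \<tau>\<^sup>2 < integral {x-s..x+s} h"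
      proof (rule ccontr)
        assume "\<not> ?thesis"
        then have "integral {x-s..x+s} h \<le> 2 * s * \<tau>\<^sup>2" if "0 < s" "s \<le> 1/2" for s
          using that not_less by blast
        from poisson_integral_le_maximal[OF h q this] big show False by simp
      qed
    qed (use \<tau> h h0 in \<open>auto simp: SR_def\<close>)
    then obtain T where T: "T \<in> sets borel" "SR R \<subseteq> T" "emeasure lborel T \<le> ennreal (5 / \<tau>\<^sup>2 * integral {-1..2} h)"
      by blast
    have unit: "integral {a..a+1} h \<le> (\<Sum>n. (norm (b n))\<^sup>2)" for a
    proof -
      have "(\<lambda>n. (norm (c n))\<^sup>2) sums integral {a..a+1} h"
        unfolding h_def by (rule parseval_trig_series[OF c])
      then have "integral {a..a+1} h = (\<Sum>n. (norm (c n))\<^sup>2)" "summable (\<lambda>n. (norm (c n))\<^sup>2)"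
        by (auto simp: sums_iff)
      moreover have "(norm (c n))\<^sup>2 \<le> (norm (b n))\<^sup>2" for n
        unfolding c_def using R
        by (intro power_mono) (auto simp: norm_mult norm_power power_le_one mult_left_le)
      ultimately show ?thesis using suminf_le[OF _ _ b2] by simp
    qed
    have hi: "h integrable_on {a..b}" for a b by (intro integrable_continuous_interval h)
    have "integral {-1..2} h = integral {-1..0} h + (integral {0..1} h + integral {1..2} h)"
      by (simp add: Henstock_Kurzweil_Integration.integral_combine hi)
    also have "\<dots> \<le> 3 * (\<Sum>n. (norm (b n))\<^sup>2)"
      using unit[of "-1"] unit[of 0] unit[of 1] by simp
    finally have "5 / \<tau>\<^sup>2 * integral {-1..2} h \<le> 15 / \<tau>\<^sup>2 * (\<Sum>n. (norm (b n))\<^sup>2)"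
      using \<tau> by (simp add: divide_simps)
    then have "ennreal (5 / \<tau>\<^sup>2 * integral {-1..2} h) \<le> ennreal (15 / \<tau>\<^sup>2 * (\<Sum>n. (norm (b n))\<^sup>2))"
      by (rule ennreal_leI)
    moreover have "emeasure lborel (SR R) \<le> emeasure lborel T"
      using T by (intro emeasure_mono) auto
    ultimately show ?thesis using T(3) by order
  qed
  \<comment> \<open>The sets \<open>SR (R k)\<close> increase to \<open>S\<close>, and the uniform
    bound passes to \<open>S\<close> by continuity from below.\<close>
  define R where "R k = 1 - 1 / (real k + 2)" for k
  have R: "0 < R k" "R k < 1" for k by (auto simp: R_def field_simps)
  have R_ex: "\<exists>k. r < R k" if "r < 1" for r
  proof -
    have "R \<longlonglongrightarrow> 1" unfolding R_def by real_asymp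
    from order_tendstoD(1)[OF this that] show ?thesis
      by (auto simp: eventually_sequentially)
  qed
  have "S = (\<Union>k. SR (R k))"
  proof (intro equalityI subsetI)
    fix x assume "x \<in> S"
    then obtain r where r: "x \<in> {0..1}" "0 \<le> r" "r < 1" "\<tau> < norm (?G r x)"
      unfolding S_def by auto
    obtain k where "r < R k" using R_ex[OF r(3)] by blast
    with r have "x \<in> SR (R k)" unfolding SR_def by auto
    then show "x \<in> (\<Union>k. SR (R k))" by blast
  next
    fix x assume "x \<in> (\<Union>k. SR (R k))"
    then obtain k r where r: "x \<in> {0..1}" "0 \<le> r" "r < R k" "\<tau> < norm (?G r x)"
      unfolding SR_def by auto
    with less_trans[OF r(3) R(2)] show "x \<in> S" unfolding S_def by auto
  qed
  moreover have "incseq (\<lambda>k. SR (R k))"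
  proof (intro monoI subsetI)
    fix j k :: nat and x assume "j \<le> k" "x \<in> SR (R j)"
    moreover from this obtain r where "x \<in> {0..1}" "0 \<le> r" "r < R j" "\<tau> < norm (?G r x)"
      unfolding SR_def by auto
    moreover have "R j \<le> R k" using \<open>j \<le> k\<close> by (simp add: R_def frac_le)
    ultimately show "x \<in> SR (R k)"
      unfolding SR_def by (intro CollectI conjI bexI[of _ r]) auto
  qed
  moreover have "range (\<lambda>k. SR (R k)) \<subseteq> sets lborel"
    using meas[OF less_imp_le[OF R(2)]] by auto
  ultimately have "emeasure lborel S = (SUP k. emeasure lborel (SR (R k)))"
    by (simp only: SUP_emeasure_incseq)
  also have "\<dots> \<le> ennreal (15 / \<tau>\<^sup>2 * (\<Sum>n. (norm (b n))\<^sup>2))"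
    by (intro SUP_least bound R)
  finally show "emeasure lborel S \<le> ennreal (15 / \<tau>\<^sup>2 * (\<Sum>n. (norm (b n))\<^sup>2))" .
qed


lemma tendsto_of_cauchy_filter:
  fixes f :: "'a \<Rightarrow> 'b::{uniformity_dist, complete_space}"
  assumes "F \<noteq> bot"
    and "\<And>e. e > 0 \<Longrightarrow> \<exists>P. eventually P F \<and> (\<forall>x y. P x \<and> P y \<longrightarrow> dist (f x) (f y) < e)"
  shows "\<exists>c. (f \<longlongrightarrow> c) F"
proof -
  have "cauchy_filter (filtermap f F)"
    unfolding cauchy_filter_metric_filtermap using assms(2) by blast
  from cauchy_filter_complete_converges[OF this complete_UNIV]
  show ?thesis using assms(1) by (auto simp: filterlim_def filtermap_bot_iff)
qed

lemma dist_chain4: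
  "\<lbrakk>dist a b < e / 4; dist b c < e / 4; dist d c < e / 4; dist f d < e / 4\<rbrakk> \<Longrightarrow> dist a f < e"
  by metric

theorem bounded_holomorphic_radial_limits:
  assumes hol: "g holomorphic_on ball 0 1" and bdd: "\<And>z. norm z < 1 \<Longrightarrow> norm (g z) \<le> 1"
  shows "AE x in lborel. x \<in> {0..1} \<longrightarrow> (\<exists>w. ((\<lambda>r. g (of_real r * circ x)) \<longlongrightarrow> w) (at_left 1))"
proof -
  define a where "a n = (deriv ^^ n) g 0 / fact n" for n
  have a: "(\<lambda>n. a n * z ^ n) sums g z" if "norm z < 1" for z
    using holomorphic_power_series[OF hol, of z] that by (simp add: a_def)
  have abs: "summable (\<lambda>n. norm (a n * of_real R ^ n))" if R: "0 \<le> R" "R < 1" for R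
  proof -
    obtain R' where R': "R < R'" "R' < 1" using R dense by blast
    have "summable (\<lambda>n. a n * of_real R' ^ n)" using a[of "of_real R'"] R' R by (simp add: sums_iff)
    from powser_insidea[OF this, of "of_real R"] show ?thesis using R R' by simp
  qed
  have a2: "summable (\<lambda>n. (norm (a n))\<^sup>2)"
  \<comment> \<open>Parseval on the circle of radius R bounds each weighted partial sum by 1; for
    fixed K the sum is finite, so R may tend to 1.\<close>
  proof (rule summableI_nonneg_bounded[where x=1])
    fix K
    have part: "(\<Sum>n<K. (norm (a n))\<^sup>2 * (R ^ n)\<^sup>2) \<le> 1" if R: "0 \<le> R" "R < 1" for R
    proof -
      define c where "c n = a n * of_real R ^ n" for n
      have c: "summable (\<lambda>n. norm (c n))" using abs[of R] R by (simp add: c_def)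
      have cg: "trig_series c t = g (of_real R * circ t)" for t
      proof (rule sums_unique2[OF trig_series_sums[OF c]])
        show "(\<lambda>n. c n * circ t ^ n) sums g (of_real R * circ t)"
          using a[of "of_real R * circ t"] R by (simp add: c_def norm_mult power_mult_distrib mult.assoc)
      qed
      have ps: "(\<lambda>n. (norm (c n))\<^sup>2) sums integral {0..0+1} (\<lambda>t. (norm (trig_series c t))\<^sup>2)"
        by (rule parseval_trig_series[OF c])
      then have "(\<Sum>n<K. (norm (c n))\<^sup>2) \<le> integral {0..0+1} (\<lambda>t. (norm (trig_series c t))\<^sup>2)"
        unfolding sums_iff using sum_le_suminf[of "\<lambda>n. (norm (c n))\<^sup>2" "{..<K}"] by auto
      also have "\<dots> \<le> integral {0..0+1::real} (\<lambda>t. 1)"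
      proof (intro integral_le integrable_continuous_interval continuous_intros continuous_on_trig_series c)
        fix t
        have "norm (trig_series c t) \<le> 1" unfolding cg using R by (intro bdd) (simp add: norm_mult)
        then show "(norm (trig_series c t))\<^sup>2 \<le> 1" by (simp add: power_le_one)
      qed
      finally show ?thesis using R by (simp add: c_def norm_mult norm_power power_mult_distrib)
    qed
    have "((\<lambda>R. \<Sum>n<K. (norm (a n))\<^sup>2 * (R ^ n)\<^sup>2) \<longlongrightarrow> (\<Sum>n<K. (norm (a n))\<^sup>2 * (1 ^ n)\<^sup>2)) (at_left (1::real))"
      by (intro tendsto_intros)
    moreover have "eventually (\<lambda>R. (\<Sum>n<K. (norm (a n))\<^sup>2 * (R ^ n)\<^sup>2) \<le> 1) (at_left (1::real))"
      using eventually_at_left_real[OF zero_less_one] by eventually_elim (use part in auto)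
    ultimately show "(\<Sum>n<K. (norm (a n))\<^sup>2) \<le> 1"
      using tendsto_upperbound[of _ _ "at_left (1::real)" 1] by fastforce
  qed simp
  \<comment> \<open>Coefficients of the tail; the removed part is a polynomial, hence continuous up
    to the circle.\<close>
  define b where "b N n = (if n < N then 0 else a n)" for N n :: nat
  have b_abs: "summable (\<lambda>n. norm (b N n * of_real R ^ n))" if "0 \<le> R" "R < 1" for N R
    by (rule summable_comparison_test'[OF abs[OF that]]) (auto simp: b_def)
  have b2: "summable (\<lambda>n. (norm (b N n))\<^sup>2)" for N
    by (rule summable_comparison_test'[OF a2]) (auto simp: b_def)
  have tail: "(\<lambda>N. \<Sum>n. (norm (b N n))\<^sup>2) \<longlonglongrightarrow> 0"
  proof -
    have "(\<Sum>n. (norm (b N n))\<^sup>2) = (\<Sum>n. (norm (a (n + N)))\<^sup>2)" for N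
      using suminf_split_initial_segment[OF b2, of N N] by (simp add: b_def)
    then show ?thesis using suminf_exist_split2[OF a2] by simp
  qed
  have split: "g z = (\<Sum>n<N. a n * z ^ n) + (\<Sum>n. b N n * z ^ n)" if "norm z < 1" for z N
  proof -
    have "(\<lambda>n. if n < N then a n * z ^ n else 0) sums (\<Sum>n<N. a n * z ^ n)"
      using sums_If_finite[of "\<lambda>n. n < N" "\<lambda>n. a n * z ^ n"] by (simp add: lessThan_def)
    from sums_diff[OF a[OF that] this]
    have "(\<lambda>n. a n * z ^ n - (if n < N then a n * z ^ n else 0)) sums (g z - (\<Sum>n<N. a n * z ^ n))" .
    moreover have "(\<lambda>n. a n * z ^ n - (if n < N then a n * z ^ n else 0)) = (\<lambda>n. b N n * z ^ n)"
      by (auto simp: b_def)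
    ultimately show ?thesis by (simp add: sums_iff)
  qed
  define S where "S N j = {x\<in>{0..1}. \<exists>r\<in>{0..<1}. 1 / real (Suc j) < norm (\<Sum>n. b N n * (of_real r * circ x) ^ n)}" for N j
  have S: "S N j \<in> sets borel" "emeasure lborel (S N j) \<le> ennreal (15 / (1 / real (Suc j))\<^sup>2 * (\<Sum>n. (norm (b N n))\<^sup>2))" for N j
    unfolding S_def by (rule power_series_maximal_weak_type; simp add: b_abs b2)+
  \<comment> \<open>With the threshold fixed, the weak type bound is a constant times the squared
    norm of the tail, which tends to 0.\<close>
  have null: "(\<Inter>N. S N j) \<in> null_sets lborel" for j
  proof -
    have "(\<lambda>N. ennreal (15 / (1 / real (Suc j))\<^sup>2 * (\<Sum>n. (norm (b N n))\<^sup>2))) \<longlonglongrightarrow> ennreal (15 / (1 / real (Suc j))\<^sup>2 * 0)"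
      by (intro tendsto_intros tail)
    moreover have "emeasure lborel (\<Inter>N. S N j) \<le> ennreal (15 / (1 / real (Suc j))\<^sup>2 * (\<Sum>n. (norm (b N n))\<^sup>2))" for N
      using S by (intro order_trans[OF emeasure_mono S(2)]) auto
    ultimately have "emeasure lborel (\<Inter>N. S N j) \<le> ennreal (15 / (1 / real (Suc j))\<^sup>2 * 0)"
      by (intro LIMSEQ_le_const) auto
    then show ?thesis using S(1) by (auto simp: null_sets_def)
  qed
  then have "AE x in lborel. x \<notin> (\<Union>j. \<Inter>N. S N j)"
    by (intro AE_not_in null_sets_UN)
  then show ?thesis
  proof eventually_elim
    case (elim x)
    show ?case
    proof
      assume x: "x \<in> {0..1}"
      show "\<exists>w. ((\<lambda>r. g (of_real r * circ x)) \<longlongrightarrow> w) (at_left 1)"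
      proof (rule tendsto_of_cauchy_filter)
        fix e :: real assume "e > 0"
        then obtain j where j: "1 / real (Suc j) < e / 4"
          using reals_Archimedean[of "e/4"] by (auto simp: inverse_eq_divide)
        obtain N where "x \<notin> S N j" using elim by blast
        \<comment> \<open>The tail is small along the whole radius ending at
          \<open>circ x\<close>.\<close>
        then have q: "norm (\<Sum>n. b N n * (of_real r * circ x) ^ n) < e / 4" if "0 \<le> r" "r < 1" for r
          using x that j unfolding S_def by (auto dest!: bspec[of _ _ r] simp: not_less)
        \<comment> \<open>The four quarters of e pay for the tail at r, the polynomial at r, the
          polynomial at r', and the tail at r'.\<close>
        define p where "p z = (\<Sum>n<N. a n * z ^ n)" for z
        have "((\<lambda>r. p (of_real r * circ x)) \<longlongrightarrow> p (of_real 1 * circ x)) (at_left 1)"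
          unfolding p_def by (intro tendsto_intros)
        then have "eventually (\<lambda>r. dist (p (of_real r * circ x)) (p (of_real 1 * circ x)) < e / 4) (at_left 1)"
          using \<open>e > 0\<close> by (intro tendstoD) auto
        moreover have "eventually (\<lambda>r. r \<in> {0<..<1}) (at_left (1::real))"
          by (rule eventually_at_left_real) simp
        ultimately have "eventually (\<lambda>r. 0 < r \<and> r < 1 \<and> dist (p (of_real r * circ x)) (p (of_real 1 * circ x)) < e / 4) (at_left 1)"
          by eventually_elim auto
        moreover have "dist (g (of_real r * circ x)) (g (of_real r' * circ x)) < e"
          if r: "0 < r" "r < 1" "dist (p (of_real r * circ x)) (p (of_real 1 * circ x)) < e / 4"
           and r': "0 < r'" "r' < 1" "dist (p (of_real r' * circ x)) (p (of_real 1 * circ x)) < e / 4" for r r'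
        proof -
          have "dist (g (of_real s * circ x)) (p (of_real s * circ x)) < e / 4" if "0 < s" "s < 1" for s
            using split[of "of_real s * circ x" N] q[of s] that by (simp add: p_def dist_norm norm_mult)
          note gp = this
          show ?thesis
            by (rule dist_chain4[OF gp[OF r(1,2)] r(3) r'(3) gp[OF r'(1,2)]])
        qed
        ultimately show "\<exists>P. eventually P (at_left 1) \<and> (\<forall>r r'. P r \<and> P r' \<longrightarrow>
            dist (g (of_real r * circ x)) (g (of_real r' * circ x)) < e)"
          by blast
      qed simp
    qed
  qed
qed

section \<open>Poisson integrals of integrable functions\<close>

text \<open>Half-open, so that \<open>circ\<close> maps it bijectively onto the circle. It carries
  Borel sets only; the completion is handled when passing to \<open>circle_measure\<close>.\<close>

definition unit_interval :: "real measure" where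
  "unit_interval = restrict_space lborel {0..<1}"

lemma space_unit_interval [simp]: "space unit_interval = {0..<1}"
  by (simp add: unit_interval_def space_restrict_space)

interpretation unit_interval: prob_space unit_interval
  unfolding unit_interval_def by (rule prob_space_restrict_space) auto

interpretation unit_interval_pair: pair_prob_space unit_interval unit_interval ..

lemma measurable_unit_interval_borel [measurable]: "(\<lambda>x. x) \<in> measurable unit_interval borel"
  unfolding unit_interval_def by (rule measurable_restrict_space1) simp

lemma borel_measurable_unit_interval: "f \<in> borel_measurable borel \<Longrightarrow> f \<in> borel_measurable unit_interval"
  using measurable_compose[OF measurable_unit_interval_borel] .

lemma AE_unit_interval_iff: "(AE x in unit_interval. P x) \<longleftrightarrow> (AE x in lborel. x \<in> {0..<1} \<longrightarrow> P x)"
  unfolding unit_interval_def by (rule AE_restrict_space_iff) simp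

lemma AE_unit_interval_neq: "AE x in unit_interval. x \<noteq> a"
  unfolding AE_unit_interval_iff using AE_lborel_singleton[of a] by eventually_elim simp

lemma integral_unit_interval_continuous:
  fixes F :: "real \<Rightarrow> real"
  assumes "continuous_on UNIV F"
  shows "(LINT x|unit_interval. F x) = integral {0..1} F"
proof -
  have [measurable]: "F \<in> borel_measurable borel" by (rule borel_measurable_continuous_onI[OF assms])
  have "(LINT x|unit_interval. F x) = (LINT x|lborel. indicator {0..<1} x *\<^sub>R F x)"
    unfolding unit_interval_def by (rule integral_restrict_space) simp
  also have "\<dots> = (LINT x:{0..1}|lborel. F x)"
    unfolding set_lebesgue_integral_def
  proof (intro integral_cong_AE)
    show "AE x in lborel. indicator {0..<1} x *\<^sub>R F x = indicator {0..1} x *\<^sub>R F x"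
      using AE_lborel_singleton[of "1::real"] by eventually_elim (auto simp: indicator_def)
  qed auto
  also have "\<dots> = integral {0..1} F"
    by (intro set_borel_integral_eq_integral borel_integrable_atLeastAtMost' continuous_on_subset[OF assms]) simp
  finally show ?thesis .
qed

definition poisson_circ :: "real \<Rightarrow> real \<Rightarrow> real" where
  "poisson_circ r s = poisson_kernel (of_real r * circ s)"

lemma poisson_circ_nonneg: "0 \<le> r \<Longrightarrow> r < 1 \<Longrightarrow> 0 \<le> poisson_circ r s"
  unfolding poisson_circ_def by (intro poisson_kernel_nonneg) (simp add: norm_mult)

lemma poisson_circ_le:
  assumes "0 \<le> r" "r < 1" "0 < d" "d \<le> norm (1 - of_real r * circ s)"
  shows "poisson_circ r s \<le> (1 - r\<^sup>2) / d\<^sup>2"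
  unfolding poisson_circ_def poisson_kernel_eq using assms
  by (auto simp: norm_mult power_le_one intro!: divide_left_mono power_mono mult_pos_pos)

lemma poisson_circ_bounded:
  assumes "0 \<le> r" "r < 1"
  shows "poisson_circ r s \<le> (1 - r\<^sup>2) / (1 - r)\<^sup>2"
proof (rule poisson_circ_le[OF assms])
  show "1 - r \<le> norm (1 - of_real r * circ s)"
    using norm_triangle_ineq2[of 1 "of_real r * circ s"] assms by (simp add: norm_mult)
qed (use assms in simp)

lemma poisson_circ_minus: "poisson_circ r (t - s) = poisson_circ r (s - t)"
  using poisson_kernel_even[of r "s - t"] by (simp add: poisson_circ_def)

lemma continuous_on_poisson_circ: "0 \<le> r \<Longrightarrow> r < 1 \<Longrightarrow> continuous_on A (poisson_circ r)"
  unfolding poisson_circ_def[abs_def] by (rule continuous_on_poisson_kernel_circ) simp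

lemma borel_measurable_poisson_circ: "0 \<le> r \<Longrightarrow> r < 1 \<Longrightarrow> poisson_circ r \<in> borel_measurable borel"
  by (intro borel_measurable_continuous_onI continuous_on_poisson_circ)

lemma borel_measurable_poisson_circ_diff:
  assumes "0 \<le> r" "r < 1"
  shows "(\<lambda>(x, t). poisson_circ r (x - t)) \<in> borel_measurable (unit_interval \<Otimes>\<^sub>M unit_interval)"
proof -
  have [measurable]: "fst \<in> borel_measurable (unit_interval \<Otimes>\<^sub>M unit_interval)"
      "snd \<in> borel_measurable (unit_interval \<Otimes>\<^sub>M unit_interval)"
    using measurable_compose[OF measurable_fst measurable_unit_interval_borel]
      measurable_compose[OF measurable_snd measurable_unit_interval_borel] by auto
  have "(\<lambda>p. poisson_circ r (fst p - snd p)) \<in> borel_measurable (unit_interval \<Otimes>\<^sub>M unit_interval)"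
    by (rule measurable_compose[OF _ borel_measurable_poisson_circ[OF assms]]) measurable
  then show ?thesis by (simp add: case_prod_beta')
qed

lemma integral_poisson_circ:
  assumes r: "0 \<le> r" "r < 1"
  shows "(LINT x|unit_interval. poisson_circ r (x - t)) = 1"
proof -
  have "(LINT x|unit_interval. poisson_circ r (x - t)) = integral {0..1} (\<lambda>x. poisson_circ r (x - t))"
    by (intro integral_unit_interval_continuous continuous_on_compose2[OF continuous_on_poisson_circ[OF r, of UNIV]])
       (auto intro!: continuous_intros)
  also have "\<dots> = integral {-t..-t+1} (poisson_circ r)"
    using integral_shift_real_ivl[of "-t" "-t" "-t+1" "poisson_circ r"] by simp
  also have "\<dots> = 1"
    using integral_poisson_kernel[OF r, of "-t"] by (simp add: poisson_circ_def[abs_def] integral_unique)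
  finally show ?thesis .
qed

lemma integrable_mult_poisson_circ:
  assumes f: "integrable unit_interval f" and r: "0 \<le> r" "r < 1"
  shows "integrable unit_interval (\<lambda>t. f t * poisson_circ r (x - t))"
proof -
  have [measurable]: "(\<lambda>t. poisson_circ r (x - t)) \<in> borel_measurable unit_interval"
    by (intro borel_measurable_unit_interval measurable_compose[OF _ borel_measurable_poisson_circ[OF r]]) simp
  define C where "C = (1 - r\<^sup>2) / (1 - r)\<^sup>2"
  have C: "0 \<le> C" "\<And>s. poisson_circ r s \<le> C"
    using r poisson_circ_bounded[OF r] by (auto simp: C_def power_le_one)
  show ?thesis
  proof (rule Bochner_Integration.integrable_bound)
    show "integrable unit_interval (\<lambda>t. C * f t)" using f by simp
    show "AE t in unit_interval. norm (f t * poisson_circ r (x - t)) \<le> norm (C * f t)"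
      using C poisson_circ_nonneg[OF r]
      by (auto intro!: AE_I2 mult_right_mono simp: abs_mult mult.commute[of "\<bar>f _\<bar>"])
  qed (use f in measurable)
qed

definition poisson_integral :: "(real \<Rightarrow> real) \<Rightarrow> real \<Rightarrow> real \<Rightarrow> real" where
  "poisson_integral f r x = (LINT t|unit_interval. f t * poisson_circ r (x - t))"

lemma poisson_integral_nonneg:
  assumes "AE t in unit_interval. 0 \<le> f t" "0 \<le> r" "r < 1"
  shows "0 \<le> poisson_integral f r x"
  unfolding poisson_integral_def using assms
  by (intro integral_nonneg_AE) (auto intro!: mult_nonneg_nonneg poisson_circ_nonneg elim!: AE_mp)

lemma poisson_integral_mono:
  assumes "integrable unit_interval f" "integrable unit_interval h" "\<And>t. f t \<le> h t" "0 \<le> r" "r < 1"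
  shows "poisson_integral f r x \<le> poisson_integral h r x"
  unfolding poisson_integral_def using assms
  by (intro integral_mono integrable_mult_poisson_circ mult_right_mono poisson_circ_nonneg)

lemma poisson_integral_const:
  assumes "0 \<le> r" "r < 1"
  shows "poisson_integral (\<lambda>_. c) r x = c"
  unfolding poisson_integral_def
  using integral_poisson_circ[OF assms, of x] by (simp add: poisson_circ_minus[of r x])

lemma borel_measurable_poisson_integral:
  assumes f: "f \<in> borel_measurable unit_interval" and r: "0 \<le> r" "r < 1"
  shows "poisson_integral f r \<in> borel_measurable unit_interval"
proof -
  note f [measurable] borel_measurable_poisson_circ_diff[OF r, measurable]
  show ?thesis unfolding poisson_integral_def[abs_def] by measurable
qed

text \<open>The condition on \<open>X\<close> says that \<open>circ (x - t)\<close> avoids 1, and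
  compactness turns this into a uniform distance d. Once 1 - r < d / 2, the kernel is at most (1 -
  r^2) / (d / 2)^2 on \<open>X\<close>, which tends to 0.\<close>

lemma poisson_integral_indicator_tendsto:
  assumes X: "compact X" "\<And>x. x \<in> X \<Longrightarrow> x \<noteq> t \<and> \<bar>x - t\<bar> < 1"
  shows "((\<lambda>r. LINT x|unit_interval. indicator X x * poisson_circ r (x - t)) \<longlongrightarrow> 0) (at_left 1)"
proof (cases "X = {}")
  case False
  have "continuous_on X (\<lambda>x. norm (1 - circ (x - t)))" by (intro continuous_intros)
  from continuous_attains_inf[OF X(1) False this] obtain y where
    y: "y \<in> X" "\<And>x. x \<in> X \<Longrightarrow> norm (1 - circ (y - t)) \<le> norm (1 - circ (x - t))" by blast
  define d where "d = norm (1 - circ (y - t))"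
  have "circ (y - t) \<noteq> 1"
  proof
    assume "circ (y - t) = 1"
    then have "cos (2 * pi * (y - t)) = 1" by (simp add: complex_eq_iff)
    then obtain n :: int where "2 * pi * (y - t) = of_int n * (2 * pi)" by (auto simp: cos_one_2pi_int)
    then have "y - t = of_int n" by simp
    with X(2)[OF y(1)] show False by (cases "n = 0") auto
  qed
  then have d: "0 < d" by (simp add: d_def)
  have bound: "(LINT x|unit_interval. indicator X x * poisson_circ r (x - t)) \<le> (1 - r\<^sup>2) / (d / 2)\<^sup>2"
    if r: "0 \<le> r" "1 - d / 2 < r" "r < 1" for r
  proof -
    have "indicator X x * poisson_circ r (x - t) \<le> (1 - r\<^sup>2) / (d / 2)\<^sup>2" for x
    proof (cases "x \<in> X")
      case True
      have "d \<le> norm (1 - circ (x - t))" using y(2)[OF True] by (simp add: d_def)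
      also have "\<dots> \<le> norm (1 - of_real r * circ (x - t)) + norm (of_real r * circ (x - t) - circ (x - t))"
        using norm_triangle_ineq[of "1 - of_real r * circ (x - t)" "of_real r * circ (x - t) - circ (x - t)"] by simp
      also have "of_real r * circ (x - t) - circ (x - t) = of_real (r - 1) * circ (x - t)"
        by (simp add: algebra_simps)
      also have "norm \<dots> = 1 - r" unfolding norm_mult norm_of_real using r by simp
      finally have "d / 2 \<le> norm (1 - of_real r * circ (x - t))" using r by simp
      with True d r show ?thesis by (simp add: poisson_circ_le)
    qed (use r in \<open>simp add: power_le_one\<close>)
    then have "(LINT x|unit_interval. indicator X x * poisson_circ r (x - t)) \<le> (LINT x|unit_interval. (1 - r\<^sup>2) / (d / 2)\<^sup>2)"
      using r by (intro integral_mono') (auto simp: power_le_one)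
    then show ?thesis by (simp add: unit_interval.prob_space[simplified])
  qed
  have lim: "((\<lambda>r. (1 - r\<^sup>2) / (d / 2)\<^sup>2) \<longlongrightarrow> (1 - 1\<^sup>2) / (d / 2)\<^sup>2) (at_left (1::real))"
    using d by (intro tendsto_intros) auto
  have ev: "eventually (\<lambda>r. r \<in> {max 0 (1 - d / 2)<..<1}) (at_left 1)"
    using d by (intro eventually_at_left_real) auto
  show ?thesis
  proof (rule tendsto_sandwich)
    show "\<forall>\<^sub>F r in at_left 1. 0 \<le> (LINT x|unit_interval. indicator X x * poisson_circ r (x - t))"
      using ev by eventually_elim (auto intro!: Bochner_Integration.integral_nonneg mult_nonneg_nonneg poisson_circ_nonneg)
    show "\<forall>\<^sub>F r in at_left 1. (LINT x|unit_interval. indicator X x * poisson_circ r (x - t)) \<le> (1 - r\<^sup>2) / (d / 2)\<^sup>2"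
      using ev by eventually_elim (rule bound; simp)
    show "((\<lambda>r. (1 - r\<^sup>2) / (d / 2)\<^sup>2) \<longlongrightarrow> 0) (at_left (1::real))" using lim by simp
  qed simp
qed simp

text \<open>For t < a the half-line meets the interval, up to a null set, in the compact
  \<open>{a..1}\<close>, away from t. For t > a its complement \<open>{0..a}\<close> is compact and
  away from t, and the total mass is 1. The point t = 0 is left out because x near 1 is close to it
  on the circle.\<close>

lemma poisson_integral_halfline_tendsto:
  assumes t: "0 < t" "t < 1" "t \<noteq> a"
  shows "((\<lambda>r. LINT x|unit_interval. indicator {a<..} x * poisson_circ r (x - t)) \<longlongrightarrow> indicator {a<..} t) (at_left 1)"
proof (cases "t < a")
  case True
  have "((\<lambda>r. LINT x|unit_interval. indicator {a..1} x * poisson_circ r (x - t)) \<longlongrightarrow> 0) (at_left 1)"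
    using True t by (intro poisson_integral_indicator_tendsto) auto
  moreover have "(LINT x|unit_interval. indicator {a..1} x * poisson_circ r (x - t)) =
      (LINT x|unit_interval. indicator {a<..} x * poisson_circ r (x - t))" if "0 \<le> r" "r < 1" for r
  proof (rule integral_cong_AE)
    have [measurable]: "(\<lambda>x. poisson_circ r (x - t)) \<in> borel_measurable unit_interval"
      by (intro borel_measurable_unit_interval measurable_compose[OF _ borel_measurable_poisson_circ[OF that]]) simp
    have [measurable]: "indicator {a..1} \<in> borel_measurable unit_interval" "indicator {a<..} \<in> borel_measurable unit_interval"
      by (auto intro: borel_measurable_unit_interval)
    show "(\<lambda>x. indicator {a..1} x * poisson_circ r (x - t)) \<in> borel_measurable unit_interval"
      "(\<lambda>x. indicator {a<..} x * poisson_circ r (x - t)) \<in> borel_measurable unit_interval" by measurable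
    show "AE x in unit_interval. indicator {a..1} x * poisson_circ r (x - t) = indicator {a<..} x * poisson_circ r (x - t)"
      using AE_unit_interval_neq[of a] AE_space by eventually_elim (auto simp: indicator_def)
  qed
  ultimately have "((\<lambda>r. LINT x|unit_interval. indicator {a<..} x * poisson_circ r (x - t)) \<longlongrightarrow> 0) (at_left 1)"
    using eventually_at_left_real[OF zero_less_one]
    by (elim Lim_transform_eventually) (auto elim!: eventually_mono)
  then show ?thesis using True by simp
next
  case False
  have "((\<lambda>r. LINT x|unit_interval. indicator {0..a} x * poisson_circ r (x - t)) \<longlongrightarrow> 0) (at_left 1)"
    using False t by (intro poisson_integral_indicator_tendsto) auto
  then have "((\<lambda>r. 1 - (LINT x|unit_interval. indicator {0..a} x * poisson_circ r (x - t))) \<longlongrightarrow> 1 - 0) (at_left 1)"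
    by (intro tendsto_intros)
  moreover have "1 - (LINT x|unit_interval. indicator {0..a} x * poisson_circ r (x - t)) =
      (LINT x|unit_interval. indicator {a<..} x * poisson_circ r (x - t))" if r: "0 \<le> r" "r < 1" for r
  proof -
    have int: "integrable unit_interval (\<lambda>x. indicator A x * poisson_circ r (x - t))" if "A \<in> sets borel" for A
    proof -
      have "indicator A \<in> borel_measurable unit_interval"
        using that by (intro borel_measurable_unit_interval) auto
      then have "integrable unit_interval (indicator A :: real \<Rightarrow> real)"
        by (intro unit_interval.integrable_const_bound[of _ 1]) (auto simp: indicator_def)
      from integrable_mult_poisson_circ[OF this r, of t] show ?thesis
        by (simp add: poisson_circ_minus[of r t])
    qed
    have "(LINT x|unit_interval. indicator {0..a} x * poisson_circ r (x - t)) +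
        (LINT x|unit_interval. indicator {a<..} x * poisson_circ r (x - t)) =
      (LINT x|unit_interval. indicator {0..a} x * poisson_circ r (x - t) + indicator {a<..} x * poisson_circ r (x - t))"
      by (intro Bochner_Integration.integral_add[symmetric] int) auto
    also have "\<dots> = (LINT x|unit_interval. poisson_circ r (x - t))"
      by (intro Bochner_Integration.integral_cong) (auto simp: indicator_def)
    finally show ?thesis using integral_poisson_circ[OF r] by simp
  qed
  ultimately have "((\<lambda>r. LINT x|unit_interval. indicator {a<..} x * poisson_circ r (x - t)) \<longlongrightarrow> 1) (at_left 1)"
    using eventually_at_left_real[OF zero_less_one]
    by (simp, elim Lim_transform_eventually) (auto elim!: eventually_mono)
  then show ?thesis using False t by simp
qed

section \<open>Herglotz transforms\<close>

text \<open>Both functions are densities of finite measures. Pushed forward to the Borel line, these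
  are determined by their values on open rays; uniqueness of densities then returns to the
  functions.\<close>

lemma AE_eq_of_halfline_integrals:
  fixes f f' :: "real \<Rightarrow> real"
  assumes f: "integrable unit_interval f" "AE x in unit_interval. 0 \<le> f x"
    and f': "integrable unit_interval f'" "AE x in unit_interval. 0 \<le> f' x"
    and eq: "\<And>a. (LINT x|unit_interval. indicator {a<..} x * f x) = (LINT x|unit_interval. indicator {a<..} x * f' x)"
  shows "AE x in unit_interval. f x = f' x"
proof -
  define D where "D h = density unit_interval (\<lambda>x. ennreal (h x))" for h :: "real \<Rightarrow> real"
  define M where "M h = distr (D h) borel (\<lambda>x. x)" for h
  have [measurable]: "f \<in> borel_measurable unit_interval" "f' \<in> borel_measurable unit_interval"
    using f f' by auto
  have id: "(\<lambda>x. x) \<in> measurable (D h) borel" for h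
    unfolding D_def by simp
  have M: "emeasure (M h) A = emeasure (D h) (A \<inter> {0..<1})" if "A \<in> sets borel" for h A
    unfolding M_def using that by (subst emeasure_distr[OF id]) (auto simp: D_def vimage_def Int_def)
  have ray: "emeasure (M h) {a<..} = ennreal (LINT x|unit_interval. indicator {a<..} x * h x)"
    if h: "integrable unit_interval h" "AE x in unit_interval. 0 \<le> h x" for h a
  proof -
    have hm: "(\<lambda>x. ennreal (h x)) \<in> borel_measurable unit_interval" using h by simp
    have A: "{a<..} \<inter> {0..<1} \<in> sets unit_interval"
      by (auto simp: unit_interval_def sets_restrict_space)
    have [measurable]: "indicator {a<..} \<in> borel_measurable unit_interval"
      by (rule borel_measurable_unit_interval) simp
    have "emeasure (M h) {a<..} = (\<integral>\<^sup>+x. ennreal (h x) * indicator ({a<..} \<inter> {0..<1}) x \<partial>unit_interval)"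
      using emeasure_density[OF hm A] by (simp add: M D_def)
    also have "\<dots> = (\<integral>\<^sup>+x. ennreal (indicator {a<..} x * h x) \<partial>unit_interval)"
      by (intro nn_integral_cong) (auto simp: indicator_def)
    also have "\<dots> = ennreal (LINT x|unit_interval. indicator {a<..} x * h x)"
    proof (rule nn_integral_eq_integral)
      show "integrable unit_interval (\<lambda>x. indicator {a<..} x * h x)"
        using h(1) by (rule Bochner_Integration.integrable_bound) (use h(1) in \<open>auto simp: indicator_def\<close>)
      show "AE x in unit_interval. 0 \<le> indicator {a<..} x * h x"
        using h(2) by eventually_elim simp
    qed
    finally show ?thesis .
  qed
  have "M f = M f'"
  proof (rule measure_eqI_lessThan)
    show "emeasure (M f) {a<..} = emeasure (M f') {a<..}" for a
      using ray[OF f] ray[OF f'] eq by simp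
    show "emeasure (M f) {a<..} < \<infinity>" for a
      using ray[OF f] by simp
  qed (auto simp: M_def)
  have "D f = D f'"
  proof (rule measure_eqI)
    fix B assume "B \<in> sets (D f)"
    then obtain A where "A \<in> sets borel" "B = A \<inter> {0..<1}"
      by (auto simp: D_def unit_interval_def sets_restrict_space)
    with M[of A f] M[of A f'] \<open>M f = M f'\<close> show "emeasure (D f) B = emeasure (D f') B" by simp
  qed (simp add: D_def)
  then have "AE x in unit_interval. ennreal (f x) = ennreal (f' x)"
    unfolding D_def by (intro unit_interval.density_unique) auto
  with f(2) f'(2) show ?thesis by eventually_elim simp
qed

section \<open>Herglotz transforms as holomorphic functions\<close>

definition herglotz_transform :: "(real \<Rightarrow> real) \<Rightarrow> complex \<Rightarrow> complex" where
  "herglotz_transform f z = (LINT t|unit_interval. of_real (f t) * herglotz_kernel (z * cnj (circ t)))"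

lemma integrable_mult_circ_power:
  assumes f: "integrable unit_interval f"
  shows "integrable unit_interval (\<lambda>t. complex_of_real (f t) * cnj (circ t) ^ n)"
proof (rule Bochner_Integration.integrable_bound[OF f])
  have [measurable]: "(\<lambda>t. cnj (circ t) ^ n) \<in> borel_measurable unit_interval"
    by (intro borel_measurable_unit_interval borel_measurable_continuous_onI continuous_intros)
  have [measurable]: "f \<in> borel_measurable unit_interval" using f by simp
  show "(\<lambda>t. complex_of_real (f t) * cnj (circ t) ^ n) \<in> borel_measurable unit_interval" by measurable
qed (simp add: norm_mult norm_power)

text \<open>The kernel is expanded and integrated term by term, with the terms dominated by 2 |z|^n
  |f t|. The expansion makes the transform holomorphic without differentiating under the
  integral.\<close>

lemma herglotz_transform_power_series:
  assumes f: "integrable unit_interval f" and z: "norm z < 1"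
  shows "integrable unit_interval (\<lambda>t. of_real (f t) * herglotz_kernel (z * cnj (circ t)))"
    and "(\<lambda>n. (if n = 0 then 1 else 2) * (LINT t|unit_interval. of_real (f t) * cnj (circ t) ^ n) * z ^ n)
           sums herglotz_transform f z"
proof -
  define h :: "nat \<Rightarrow> complex" where "h n = (if n = 0 then 1 else 2)" for n
  define F where "F n t = h n * z ^ n * (of_real (f t) * cnj (circ t) ^ n)" for n t
  have F: "integrable unit_interval (F n)" for n
    unfolding F_def[abs_def] by (intro Bochner_Integration.integrable_mult_right integrable_mult_circ_power f)
  have nF: "norm (F n t) = norm (h n * z ^ n) * \<bar>f t\<bar>" for n t
    by (simp add: F_def norm_mult norm_power)
  have "summable (\<lambda>n. 2 * norm z ^ n)" using z by (simp add: summable_mult summable_geometric)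
  then have hz: "summable (\<lambda>n. norm (h n * z ^ n))"
    by (rule summable_comparison_test') (auto simp: h_def norm_mult norm_power)
  have s1: "AE t in unit_interval. summable (\<lambda>n. norm (F n t))"
    unfolding nF using hz by (intro AE_I2 summable_mult2)
  have s2: "summable (\<lambda>n. LINT t|unit_interval. norm (F n t))"
    unfolding nF using hz by (simp add: summable_mult2)
  have suminf: "(\<Sum>n. F n t) = of_real (f t) * herglotz_kernel (z * cnj (circ t))" for t
  proof -
    have "(\<lambda>n. h n * (z * cnj (circ t)) ^ n) sums herglotz_kernel (z * cnj (circ t))"
      unfolding h_def by (rule herglotz_kernel_sums) (use z in \<open>simp add: norm_mult\<close>)
    from sums_mult[OF this, of "of_real (f t)"]
    have "(\<lambda>n. F n t) sums (of_real (f t) * herglotz_kernel (z * cnj (circ t)))"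
      by (simp only: F_def power_mult_distrib mult_ac)
    then show ?thesis by (rule sums_unique[symmetric])
  qed
  show "integrable unit_interval (\<lambda>t. of_real (f t) * herglotz_kernel (z * cnj (circ t)))"
    using integrable_suminf[OF F s1 s2] by (simp only: suminf)
  have "(\<lambda>n. LINT t|unit_interval. F n t) sums herglotz_transform f z"
    using sums_integral[OF F s1 s2] by (simp only: suminf herglotz_transform_def)
  moreover have "(LINT t|unit_interval. F n t) = h n * (LINT t|unit_interval. of_real (f t) * cnj (circ t) ^ n) * z ^ n" for n
    unfolding F_def integral_mult_right_zero by simp
  ultimately show "(\<lambda>n. (if n = 0 then 1 else 2) * (LINT t|unit_interval. of_real (f t) * cnj (circ t) ^ n) * z ^ n)
           sums herglotz_transform f z"
    by (simp only: h_def)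
qed

lemma herglotz_transform_holomorphic:
  assumes "integrable unit_interval f"
  shows "herglotz_transform f holomorphic_on ball 0 1"
  by (rule power_series_holomorphic[where a="\<lambda>n. (if n = 0 then 1 else 2) * (LINT t|unit_interval. of_real (f t) * cnj (circ t) ^ n)"])
     (use herglotz_transform_power_series(2)[OF assms] in simp)

lemma Re_herglotz_transform:
  assumes f: "integrable unit_interval f" and r: "0 \<le> r" "r < 1"
  shows "Re (herglotz_transform f (of_real r * circ x)) = poisson_integral f r x"
proof -
  have eq: "of_real r * circ x * cnj (circ t) = of_real r * circ (x - t)" for t
    by (simp add: cis_cnj cis_mult right_diff_distrib)
  have "norm (of_real r * circ x) < 1" using r by (simp add: norm_mult)
  from integral_Re[OF herglotz_transform_power_series(1)[OF f this]]
  show ?thesis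
    by (simp add: herglotz_transform_def poisson_integral_def poisson_circ_def poisson_kernel_def eq)
qed

text \<open>The bridge between the two halves of the argument: the squared modulus of the bounded
  holomorphic function is governed by the Poisson integral of the density.\<close>

lemma norm_exp_herglotz_transform:
  assumes f: "integrable unit_interval f" and r: "0 \<le> r" "r < 1"
  shows "(norm (exp (- herglotz_transform f (of_real r * circ x) / 2)))\<^sup>2 = exp (- poisson_integral f r x)"
  by (simp add: Re_herglotz_transform[OF f r] flip: exp_double)

lemma norm_unit_disc_polar:
  assumes "norm z < 1"
  obtains r x where "0 \<le> r" "r < 1" "z = of_real r * circ x"
proof
  show "z = of_real (norm z) * circ (Arg z / (2 * pi))"
    using rcis_cmod_Arg[of z] by (simp add: rcis_def)
qed (use assms in auto)

lemma exp_herglotz_transform_radial_limits: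
  assumes f: "integrable unit_interval f" "AE t in unit_interval. 0 \<le> f t"
  shows "AE x in unit_interval. \<exists>w. ((\<lambda>r. exp (- herglotz_transform f (of_real r * circ x) / 2)) \<longlongrightarrow> w) (at_left 1)"
proof -
  have "AE x in lborel. x \<in> {0..1} \<longrightarrow>
      (\<exists>w. ((\<lambda>r. exp (- herglotz_transform f (of_real r * circ x) / 2)) \<longlongrightarrow> w) (at_left 1))"
  proof (rule bounded_holomorphic_radial_limits)
    show "(\<lambda>z. exp (- herglotz_transform f z / 2)) holomorphic_on ball 0 1"
      by (intro holomorphic_intros herglotz_transform_holomorphic f) auto
    fix z :: complex assume "norm z < 1"
    then obtain r x where r: "0 \<le> r" "r < 1" and z: "z = of_real r * circ x"
      by (rule norm_unit_disc_polar)
    have "Re (herglotz_transform f z) \<ge> 0"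
      using poisson_integral_nonneg[OF f(2) r] by (simp add: z Re_herglotz_transform[OF f(1) r])
    then show "norm (exp (- herglotz_transform f z / 2)) \<le> 1" by simp
  qed
  then show ?thesis unfolding AE_unit_interval_iff by eventually_elim auto
qed

text \<open>A fixed sequence increasing to 1, since measurability of limits, dominated convergence
  and Fatou's lemma need sequences instead of the filter \<open>at_left 1\<close>.\<close>

definition radii :: "nat \<Rightarrow> real" where "radii k = 1 - 1 / (real k + 2)"

lemma radii: "0 < radii k" "radii k < 1"
  by (auto simp: radii_def field_simps)

lemma radii_at_left: "filterlim radii (at_left 1) sequentially"
  unfolding radii_def[abs_def] by real_asymp

text \<open>For bounded f the integrand on the square is bounded, so Fubini applies and the kernel
  acts on the half-line instead of on f.\<close>

lemma integral_indicator_poisson_integral: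
  assumes f: "f \<in> borel_measurable unit_interval" "\<And>t. \<bar>f t\<bar> \<le> N" and r: "0 \<le> r" "r < 1"
  shows "(LINT x|unit_interval. indicator {a<..} x * poisson_integral f r x) =
         (LINT t|unit_interval. f t * (LINT x|unit_interval. indicator {a<..} x * poisson_circ r (x - t)))"
proof -
  have [measurable]: "indicator {a<..} \<in> borel_measurable unit_interval"
    by (rule borel_measurable_unit_interval) simp
  note f(1)[measurable] borel_measurable_poisson_circ_diff[OF r, measurable]
  have "integrable (unit_interval \<Otimes>\<^sub>M unit_interval)
      (case_prod (\<lambda>x t. indicator {a<..} x * (f t * poisson_circ r (x - t))))"
  proof (rule unit_interval_pair.integrable_const_bound)
    show "AE p in unit_interval \<Otimes>\<^sub>M unit_interval.
        norm (case p of (x, t) \<Rightarrow> indicator {a<..} x * (f t * poisson_circ r (x - t))) \<le> N * ((1 - r\<^sup>2) / (1 - r)\<^sup>2)"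
    proof (rule AE_I2, unfold split_beta)
      fix p :: "real \<times> real"
      have "\<bar>f (snd p)\<bar> * poisson_circ r (fst p - snd p) \<le> N * ((1 - r\<^sup>2) / (1 - r)\<^sup>2)"
        using f(2)[of "snd p"] poisson_circ_nonneg[OF r] poisson_circ_bounded[OF r] by (intro mult_mono) auto
      moreover have "norm (indicator {a<..} (fst p) * (f (snd p) * poisson_circ r (fst p - snd p)))
          \<le> \<bar>f (snd p)\<bar> * poisson_circ r (fst p - snd p)"
        using poisson_circ_nonneg[OF r] by (simp add: abs_mult indicator_def)
      ultimately show "norm (indicator {a<..} (fst p) * (f (snd p) * poisson_circ r (fst p - snd p)))
          \<le> N * ((1 - r\<^sup>2) / (1 - r)\<^sup>2)"
        by (rule order_trans[rotated])
    qed
  qed measurable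
  from unit_interval_pair.Fubini_integral[OF this]
  have "(LINT x|unit_interval. LINT t|unit_interval. indicator {a<..} x * (f t * poisson_circ r (x - t))) =
      (LINT t|unit_interval. LINT x|unit_interval. f t * (indicator {a<..} x * poisson_circ r (x - t)))"
    by (simp add: mult.left_commute)
  then show ?thesis by (simp add: poisson_integral_def)
qed

text \<open>Convergence tested against half-lines: after Fubini the factors \<open>v k\<close> lie
  between 0 and 1 and converge to the indicator, so N dominates.\<close>

lemma poisson_integral_halfline_limit:
  assumes f: "f \<in> borel_measurable unit_interval" "\<And>t. \<bar>f t\<bar> \<le> N"
  shows "(\<lambda>k. LINT x|unit_interval. indicator {a<..} x * poisson_integral f (radii k) x) \<longlonglongrightarrow>
         (LINT t|unit_interval. indicator {a<..} t * f t)"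
proof -
  have [measurable]: "indicator {a<..} \<in> borel_measurable unit_interval"
    by (rule borel_measurable_unit_interval) simp
  note f(1)[measurable]
  define v where "v k t = (LINT x|unit_interval. indicator {a<..} x * poisson_circ (radii k) (x - t))" for k t
  have r: "0 \<le> radii k" "radii k < 1" for k using radii[of k] by auto
  have vm [measurable]: "v k \<in> borel_measurable unit_interval" for k
  proof -
    have "(\<lambda>p. (\<lambda>(x,t). poisson_circ (radii k) (x - t)) (snd p, fst p)) \<in> borel_measurable (unit_interval \<Otimes>\<^sub>M unit_interval)"
      by (rule measurable_compose[OF _ borel_measurable_poisson_circ_diff[OF r]]) measurable
    then have [measurable]: "(\<lambda>(t, x). poisson_circ (radii k) (x - t)) \<in> borel_measurable (unit_interval \<Otimes>\<^sub>M unit_interval)"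
      by (simp add: case_prod_beta')
    show ?thesis unfolding v_def[abs_def] by measurable
  qed
  have v01: "0 \<le> v k t" "v k t \<le> 1" for k t
  proof -
    show "0 \<le> v k t" unfolding v_def
      by (intro Bochner_Integration.integral_nonneg mult_nonneg_nonneg poisson_circ_nonneg r) auto
    have "integrable unit_interval (\<lambda>x. poisson_circ (radii k) (x - t))"
      using integrable_mult_poisson_circ[OF unit_interval.integrable_const[of 1] r, of k t]
      by (simp add: poisson_circ_minus[of _ t])
    then have "v k t \<le> (LINT x|unit_interval. poisson_circ (radii k) (x - t))"
      unfolding v_def by (intro integral_mono') (auto simp: indicator_def poisson_circ_nonneg r)
    then show "v k t \<le> 1" by (simp add: integral_poisson_circ r)
  qed
  have "(\<lambda>k. LINT t|unit_interval. f t * v k t) \<longlonglongrightarrow> (LINT t|unit_interval. indicator {a<..} t * f t)"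
  proof (rule integral_dominated_convergence[where w="\<lambda>_. N"])
    show "AE t in unit_interval. (\<lambda>k. f t * v k t) \<longlonglongrightarrow> indicator {a<..} t * f t"
      using AE_unit_interval_neq[of a] AE_unit_interval_neq[of 0] AE_space
    proof eventually_elim
      case (elim t)
      then have "0 < t" "t < 1" "t \<noteq> a" by auto
      from filterlim_compose[OF poisson_integral_halfline_tendsto[OF this] radii_at_left]
      have "(\<lambda>k. v k t) \<longlonglongrightarrow> indicator {a<..} t" by (simp add: v_def)
      from tendsto_mult[OF tendsto_const[of "f t"] this] show ?case by (simp add: mult.commute)
    qed
    show "AE t in unit_interval. norm (f t * v k t) \<le> N" for k
    proof (rule AE_I2)
      fix t
      have "\<bar>f t\<bar> * v k t \<le> N * 1"
        using f(2)[of t] v01[of k t] by (intro mult_mono) auto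
      then show "norm (f t * v k t) \<le> N" using v01[of k t] by (simp add: abs_mult)
    qed
  qed auto
  then show ?thesis
    by (simp add: integral_indicator_poisson_integral[OF f r] v_def)
qed

section \<open>Fatou's theorem for the density\<close>

lemma poisson_integral_radial_limit_bounded:
  assumes f: "f \<in> borel_measurable unit_interval" "\<And>t. 0 \<le> f t" "\<And>t. f t \<le> N"
  shows "AE x in unit_interval. ((\<lambda>r. poisson_integral f r x) \<longlongrightarrow> f x) (at_left 1)"
proof -
  have absf: "\<bar>f t\<bar> \<le> N" for t using f(2,3)[of t] by simp
  have intf: "integrable unit_interval f"
    using absf by (intro unit_interval.integrable_const_bound[of _ N]) (auto simp: f(1))
  have f0: "AE t in unit_interval. 0 \<le> f t" using f(2) by simp
  have uN: "poisson_integral f r x \<le> N" if "0 \<le> r" "r < 1" for r x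
    using poisson_integral_mono[OF intf unit_interval.integrable_const f(3) that] poisson_integral_const[OF that]
    by metis
  have u0: "0 \<le> poisson_integral f r x" if "0 \<le> r" "r < 1" for r x
    by (rule poisson_integral_nonneg[OF f0 that])
  \<comment> \<open>Along the sequence \<open>radii\<close> this gives a total measurable function,
    which almost everywhere is the radial limit.\<close>
  define l where "l x = lim (\<lambda>k. poisson_integral f (radii k) x)" for x
  have r: "0 \<le> radii k" "radii k < 1" for k using radii[of k] by auto
  have lim: "AE x in unit_interval. ((\<lambda>r. poisson_integral f r x) \<longlongrightarrow> l x) (at_left 1)"
    using exp_herglotz_transform_radial_limits[OF intf f0]
  proof eventually_elim
    case (elim x)
    then obtain w where "((\<lambda>r. exp (- herglotz_transform f (of_real r * circ x) / 2)) \<longlongrightarrow> w) (at_left 1)" by blast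
    then have "((\<lambda>r. (norm (exp (- herglotz_transform f (of_real r * circ x) / 2)))\<^sup>2) \<longlongrightarrow> (norm w)\<^sup>2) (at_left 1)"
      by (intro tendsto_intros)
    moreover have ev: "\<forall>\<^sub>F r in at_left 1. r \<in> {0<..<1::real}"
      by (rule eventually_at_left_real) simp
    ultimately have e: "((\<lambda>r. exp (- poisson_integral f r x)) \<longlongrightarrow> (norm w)\<^sup>2) (at_left 1)"
      by (elim Lim_transform_eventually) (auto elim!: eventually_mono simp only: norm_exp_herglotz_transform[OF intf] greaterThanLessThan_iff less_imp_le)
    have "\<forall>\<^sub>F r in at_left 1. exp (- N) \<le> exp (- poisson_integral f r x)"
      using ev by eventually_elim (simp add: uN)
    from tendsto_lowerbound[OF e this] have "exp (- N) \<le> (norm w)\<^sup>2" by simp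
    \<comment> \<open>The bound N on f keeps the limit away from 0, which is what allows
      \<open>ln\<close> to be applied.\<close>
    then have "(norm w)\<^sup>2 \<noteq> 0" using exp_gt_zero[of "-N"] by linarith
    from tendsto_minus[OF tendsto_ln[OF e this]]
    have lim: "((\<lambda>r. poisson_integral f r x) \<longlongrightarrow> - ln ((norm w)\<^sup>2)) (at_left 1)" by simp
    moreover from filterlim_compose[OF lim radii_at_left] have "l x = - ln ((norm w)\<^sup>2)"
      unfolding l_def by (rule limI)
    ultimately show ?case by simp
  qed
  have lk: "AE x in unit_interval. (\<lambda>k. poisson_integral f (radii k) x) \<longlonglongrightarrow> l x"
    using lim by eventually_elim (rule filterlim_compose[OF _ radii_at_left])
  have um [measurable]: "poisson_integral f (radii k) \<in> borel_measurable unit_interval" for k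
    by (intro borel_measurable_poisson_integral f r)
  have lm [measurable]: "l \<in> borel_measurable unit_interval"
    unfolding l_def[abs_def] by measurable
  have l: "AE x in unit_interval. 0 \<le> l x \<and> l x \<le> N"
    using lk by eventually_elim (auto intro: LIMSEQ_le_const LIMSEQ_le_const2 u0 uN r)
  have intl: "integrable unit_interval l"
  proof (rule unit_interval.integrable_const_bound)
    show "AE x in unit_interval. norm (l x) \<le> N" using l by eventually_elim simp
  qed simp
  have "AE x in unit_interval. l x = f x"
  proof (rule AE_eq_of_halfline_integrals[OF intl _ intf f0])
    show "AE x in unit_interval. 0 \<le> l x" using l by eventually_elim simp
    fix a
    have [measurable]: "indicator {a<..} \<in> borel_measurable unit_interval"
      by (rule borel_measurable_unit_interval) simp
    have "(\<lambda>k. LINT x|unit_interval. indicator {a<..} x * poisson_integral f (radii k) x) \<longlonglongrightarrow>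
        (LINT x|unit_interval. indicator {a<..} x * l x)"
    proof (rule integral_dominated_convergence[where w="\<lambda>_. N"])
      show "AE x in unit_interval. (\<lambda>k. indicator {a<..} x * poisson_integral f (radii k) x) \<longlonglongrightarrow> indicator {a<..} x * l x"
        using lk by eventually_elim (intro tendsto_intros)
      show "AE x in unit_interval. norm (indicator {a<..} x * poisson_integral f (radii k) x) \<le> N" for k
        using u0[OF r] uN[OF r] order_trans[OF f(2,3)] by (auto simp: indicator_def)
    qed auto
    from LIMSEQ_unique[OF this poisson_integral_halfline_limit[OF f(1) absf]]
    show "(LINT x|unit_interval. indicator {a<..} x * l x) = (LINT x|unit_interval. indicator {a<..} x * f x)" .
  qed
  with lim show ?thesis by eventually_elim simp
qed

text \<open>Tonelli and the unit mass of the kernel in x. Exact conservation for every r makes the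
  right-hand side of Fatou's lemma a constant sequence.\<close>

lemma nn_integral_poisson_integral:
  assumes f: "integrable unit_interval f" "\<And>t. 0 \<le> f t" and r: "0 \<le> r" "r < 1"
  shows "(\<integral>\<^sup>+x. ennreal (poisson_integral f r x) \<partial>unit_interval) = (\<integral>\<^sup>+t. ennreal (f t) \<partial>unit_interval)"
proof -
  note borel_measurable_poisson_circ_diff[OF r, measurable]
  have [measurable]: "f \<in> borel_measurable unit_interval" using f by simp
  have "ennreal (poisson_integral f r x) = (\<integral>\<^sup>+t. ennreal (f t * poisson_circ r (x - t)) \<partial>unit_interval)" for x
    unfolding poisson_integral_def using f poisson_circ_nonneg[OF r]
    by (intro nn_integral_eq_integral[symmetric] integrable_mult_poisson_circ r) auto
  then have "(\<integral>\<^sup>+x. ennreal (poisson_integral f r x) \<partial>unit_interval) =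
      (\<integral>\<^sup>+x. \<integral>\<^sup>+t. ennreal (f t * poisson_circ r (x - t)) \<partial>unit_interval \<partial>unit_interval)" by simp
  also have "\<dots> = (\<integral>\<^sup>+t. \<integral>\<^sup>+x. ennreal (f t * poisson_circ r (x - t)) \<partial>unit_interval \<partial>unit_interval)"
    by (intro unit_interval_pair.Fubini'[symmetric]) measurable
  also have "\<dots> = (\<integral>\<^sup>+t. ennreal (f t) \<partial>unit_interval)"
  proof (intro nn_integral_cong)
    fix t
    have "integrable unit_interval (\<lambda>x. f t * poisson_circ r (x - t))"
      using integrable_mult_poisson_circ[OF unit_interval.integrable_const[of "f t"] r, of t]
      by (simp add: poisson_circ_minus[of _ t])
    then have "(\<integral>\<^sup>+x. ennreal (f t * poisson_circ r (x - t)) \<partial>unit_interval) =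
        ennreal (LINT x|unit_interval. f t * poisson_circ r (x - t))"
      using f(2) poisson_circ_nonneg[OF r] by (intro nn_integral_eq_integral) auto
    then show "(\<integral>\<^sup>+x. ennreal (f t * poisson_circ r (x - t)) \<partial>unit_interval) = ennreal (f t)"
      by (simp add: integral_poisson_circ[OF r])
  qed
  finally show ?thesis .
qed

lemma AE_eq_of_nn_integral_le:
  assumes "f \<in> borel_measurable M" "g \<in> borel_measurable M" "AE x in M. f x \<le> g x"
    and "(\<integral>\<^sup>+x. g x \<partial>M) \<le> (\<integral>\<^sup>+x. f x \<partial>M)" "(\<integral>\<^sup>+x. f x \<partial>M) \<noteq> \<infinity>"
  shows "AE x in M. g x = f x"
proof -
  have "(\<integral>\<^sup>+x. g x - f x \<partial>M) = 0"
    using nn_integral_diff[OF assms(2,1,5,3)] assms(4,5) by (simp add: diff_eq_0_iff_ennreal less_top)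
  then have "AE x in M. g x - f x = 0"
    using assms(1,2) by (subst (asm) nn_integral_0_iff_AE) auto
  with assms(3) show ?thesis
    by eventually_elim (auto intro: antisym ennreal_minus_eq_0)
qed

text \<open>If v were 0, then u would eventually exceed c + 1, against its \<open>liminf\<close>
  being c. Otherwise \<open>ln\<close> shows that u converges, and its limit is its
  \<open>liminf\<close>.\<close>

lemma exp_liminf_limit:
  fixes u :: "nat \<Rightarrow> real"
  assumes u: "\<And>k. 0 \<le> u k" and e: "(\<lambda>k. exp (- u k)) \<longlonglongrightarrow> v" and "0 \<le> v"
    and inf: "liminf (\<lambda>k. ennreal (u k)) = ennreal c" and c: "0 \<le> c"
  shows "v = exp (- c)"
proof (cases "v = 0")
  case True
  have "\<forall>\<^sub>F k in sequentially. exp (- u k) < exp (- (c + 1))"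
    using e by (rule order_tendstoD) (simp add: True)
  then have "\<forall>\<^sub>F k in sequentially. ennreal (c + 1) \<le> ennreal (u k)"
    by eventually_elim (intro ennreal_leI, simp)
  from Liminf_bounded[OF this] show ?thesis using c by (simp add: inf)
next
  case False
  from tendsto_minus[OF tendsto_ln[OF e False]] have ul: "u \<longlonglongrightarrow> - ln v" by simp
  then have "0 \<le> - ln v" by (rule LIMSEQ_le_const) (use u in auto)
  moreover have "liminf (\<lambda>k. ennreal (u k)) = ennreal (- ln v)"
    by (intro lim_imp_Liminf tendsto_ennrealI ul) simp
  ultimately have "c = - ln v" using inf c by simp
  then show ?thesis using False \<open>0 \<le> v\<close> by simp
qed

text \<open>
  Fatou's lemma and the truncations \<open>min f N\<close> bound \<open>liminf\<close> of the Poisson integrals from above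
  in mean and from below pointwise, which identifies it with \<open>f\<close>.
\<close>

lemma exp_herglotz_transform_radial_limit_nonneg:
  assumes f: "integrable unit_interval f" "\<And>t. 0 \<le> f t"
  shows "AE x in unit_interval. \<exists>w. ((\<lambda>r. exp (- herglotz_transform f (of_real r * circ x) / 2)) \<longlongrightarrow> w) (at_left 1) \<and>
           (norm w)\<^sup>2 = exp (- f x)"
proof -
  have [measurable]: "f \<in> borel_measurable unit_interval" using f by simp
  have f0: "AE t in unit_interval. 0 \<le> f t" using f(2) by simp
  have r: "0 \<le> radii k" "radii k < 1" for k using radii[of k] by auto
  have [measurable]: "poisson_integral f (radii k) \<in> borel_measurable unit_interval" for k
    by (intro borel_measurable_poisson_integral r) simp
  have u0: "0 \<le> poisson_integral f (radii k) x" for k x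
    by (rule poisson_integral_nonneg[OF f0 r])
  define U where "U x = liminf (\<lambda>k. ennreal (poisson_integral f (radii k) x))" for x
  have Um: "U \<in> borel_measurable unit_interval" unfolding U_def[abs_def] by measurable
  have "(\<integral>\<^sup>+x. U x \<partial>unit_interval) \<le> liminf (\<lambda>k. \<integral>\<^sup>+x. ennreal (poisson_integral f (radii k) x) \<partial>unit_interval)"
    unfolding U_def by (intro nn_integral_liminf) simp
  also have "\<dots> = (\<integral>\<^sup>+x. ennreal (f x) \<partial>unit_interval)"
    by (simp add: nn_integral_poisson_integral[OF f r] Liminf_const)
  finally have U_le: "(\<integral>\<^sup>+x. U x \<partial>unit_interval) \<le> (\<integral>\<^sup>+x. ennreal (f x) \<partial>unit_interval)" .
  \<comment> \<open>Natural truncation levels keep the union of the exceptional sets null.\<close>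
  have "AE x in unit_interval. \<forall>N::nat. ((\<lambda>r. poisson_integral (\<lambda>t. min (f t) N) r x) \<longlongrightarrow> min (f x) N) (at_left 1)"
    unfolding AE_all_countable
  proof
    fix N :: nat
    show "AE x in unit_interval. ((\<lambda>r. poisson_integral (\<lambda>t. min (f t) N) r x) \<longlongrightarrow> min (f x) N) (at_left 1)"
      by (rule poisson_integral_radial_limit_bounded[where N=N]) (use f in auto)
  qed
  then have f_le: "AE x in unit_interval. ennreal (f x) \<le> U x"
  proof eventually_elim
    case (elim x)
    \<comment> \<open>N depends on x: above f x the truncation does not change the value at this
      point.\<close>
    obtain N :: nat where N: "f x \<le> N" using real_arch_simple by blast
    have "(\<lambda>k. ennreal (poisson_integral (\<lambda>t. min (f t) N) (radii k) x)) \<longlonglongrightarrow> ennreal (min (f x) N)"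
      by (intro tendsto_ennrealI filterlim_compose[OF _ radii_at_left] elim[rule_format])
    then have "ennreal (f x) = liminf (\<lambda>k. ennreal (poisson_integral (\<lambda>t. min (f t) N) (radii k) x))"
      using lim_imp_Liminf N by (metis min.absorb1 trivial_limit_sequentially)
    also have "\<dots> \<le> U x"
      unfolding U_def using f
      by (intro Liminf_mono always_eventually allI ennreal_leI poisson_integral_mono r) auto
    finally show ?case .
  qed
  \<comment> \<open>f is below U pointwise and its finite mean is not exceeded by that of U, so the
    two agree almost everywhere.\<close>
  have "AE x in unit_interval. U x = ennreal (f x)"
    by (rule AE_eq_of_nn_integral_le[OF _ Um f_le U_le]) (use f in \<open>auto simp: nn_integral_eq_integral\<close>)
  with exp_herglotz_transform_radial_limits[OF f(1) f0] show ?thesis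
  proof eventually_elim
    case (elim x)
    then obtain w where w: "((\<lambda>r. exp (- herglotz_transform f (of_real r * circ x) / 2)) \<longlongrightarrow> w) (at_left 1)" by blast
    from tendsto_power[OF tendsto_norm[OF filterlim_compose[OF w radii_at_left]], of 2]
    have "(\<lambda>k. exp (- poisson_integral f (radii k) x)) \<longlonglongrightarrow> (norm w)\<^sup>2"
      by (simp only: norm_exp_herglotz_transform[OF f(1) r])
    from exp_liminf_limit[OF u0 this _ _ f(2)] elim(2) have "(norm w)\<^sup>2 = exp (- f x)"
      by (simp add: U_def)
    with w show ?case by blast
  qed
qed

theorem exp_herglotz_transform_inner_radial_limit:
  assumes f: "integrable unit_interval f"
  shows "AE x in unit_interval. \<exists>w. ((\<lambda>r. exp (- herglotz_transform f (of_real r * circ x) / 2)) \<longlongrightarrow> w) (at_left 1) \<and>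
           (norm w)\<^sup>2 = exp (- f x)"
proof -
  define p where "p t = max (f t) 0" for t
  define n where "n t = max (- f t) 0" for t
  have p: "integrable unit_interval p" "0 \<le> p t" and n: "integrable unit_interval n" "0 \<le> n t" for t
    using f by (auto simp: p_def[abs_def] n_def[abs_def])
  have fpn: "f t = p t - n t" for t by (simp add: p_def n_def max_def)
  have F: "herglotz_transform f z = herglotz_transform p z - herglotz_transform n z" if "norm z < 1" for z
    unfolding herglotz_transform_def fpn of_real_diff left_diff_distrib
    by (intro Bochner_Integration.integral_diff herglotz_transform_power_series p n that)
  from exp_herglotz_transform_radial_limit_nonneg[OF p] exp_herglotz_transform_radial_limit_nonneg[OF n]
  show ?thesis
  proof eventually_elim
    case (elim x)
    then obtain v w where v: "((\<lambda>r. exp (- herglotz_transform p (of_real r * circ x) / 2)) \<longlongrightarrow> v) (at_left 1)"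
        "(norm v)\<^sup>2 = exp (- p x)"
      and w: "((\<lambda>r. exp (- herglotz_transform n (of_real r * circ x) / 2)) \<longlongrightarrow> w) (at_left 1)"
        "(norm w)\<^sup>2 = exp (- n x)" by blast
    \<comment> \<open>The modulus of the limit, not merely its existence, is used here to
      divide.\<close>
    have "w \<noteq> 0" using w(2) by auto
    from tendsto_divide[OF v(1) w(1) this]
    have "((\<lambda>r. exp (- herglotz_transform f (of_real r * circ x) / 2)) \<longlongrightarrow> v / w) (at_left 1)"
    proof (rule Lim_transform_eventually)
      have "\<forall>\<^sub>F r in at_left 1. r \<in> {0<..<1::real}" by (rule eventually_at_left_real) simp
      then show "\<forall>\<^sub>F r in at_left 1. exp (- herglotz_transform p (of_real r * circ x) / 2) /
          exp (- herglotz_transform n (of_real r * circ x) / 2) = exp (- herglotz_transform f (of_real r * circ x) / 2)"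
        by eventually_elim (simp add: F norm_mult diff_divide_distrib flip: exp_diff)
    qed
    moreover have "(norm (v / w))\<^sup>2 = exp (- f x)"
      by (simp add: norm_divide power_divide v w fpn flip: exp_diff)
    ultimately show ?case by blast
  qed
qed

section \<open>Reflection in the circle and outer limits\<close>

text \<open>H (1 / u) = - H u, and on the circle cnj \<zeta> = 1 / \<zeta>, so replacing z by 1 /
  cnj z replaces w = z cnj \<zeta> by 1 / cnj w. At u = 1 both kernel values are the default
  0.\<close>

lemma herglotz_transform_reflect:
  assumes "z \<noteq> 0"
  shows "herglotz_transform f (1 / cnj z) = - cnj (herglotz_transform f z)"
proof -
  have "herglotz_kernel (1 / cnj z * cnj \<zeta>) = - cnj (herglotz_kernel (z * cnj \<zeta>))" if "norm \<zeta> = 1" for \<zeta>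
  proof -
    define w where "w = z * cnj \<zeta>"
    have \<zeta>: "\<zeta> * cnj \<zeta> = 1" using that by (simp flip: complex_norm_square)
    then have "\<zeta> \<noteq> 0" by auto
    then have "w \<noteq> 0" using \<open>z \<noteq> 0\<close> by (simp add: w_def)
    have "1 / cnj z * cnj \<zeta> = 1 / cnj w"
      using \<zeta> \<open>z \<noteq> 0\<close> \<open>\<zeta> \<noteq> 0\<close> by (simp add: w_def field_simps)
    moreover have "herglotz_kernel (1 / u) = - herglotz_kernel u" if "u \<noteq> 0" for u
    proof (cases "u = 1")
      case False
      then have "1 - u \<noteq> 0" "u - 1 \<noteq> 0" by auto
      then show ?thesis using that by (simp add: herglotz_kernel_def divide_simps) algebra
    qed (simp add: herglotz_kernel_def)
    ultimately show ?thesis using \<open>w \<noteq> 0\<close>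
      by (simp add: w_def herglotz_kernel_def)
  qed
  then have kernel: "herglotz_kernel (1 / cnj z * cnj (circ t)) = - cnj (herglotz_kernel (z * cnj (circ t)))" for t
    by simp
  have "cnj (herglotz_transform f z) =
      (LINT t|unit_interval. of_real (f t) * cnj (herglotz_kernel (z * cnj (circ t))))"
    unfolding herglotz_transform_def Bochner_Integration.integral_cnj[symmetric] by simp
  then show ?thesis
    unfolding herglotz_transform_def kernel by simp
qed

lemma exp_herglotz_transform_outer_radial_limit:
  assumes w: "((\<lambda>r. exp (- herglotz_transform f (of_real r * circ x) / 2)) \<longlongrightarrow> w) (at_left 1)" "w \<noteq> 0"
  shows "((\<lambda>r. exp (- herglotz_transform f (of_real r * circ x) / 2)) \<longlongrightarrow> 1 / cnj w) (at_right 1)"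
proof -
  have "filterlim (\<lambda>r::real. 1 / r) (at_left 1) (at_right 1)" by real_asymp
  from filterlim_compose[OF w(1) this]
  have "((\<lambda>r. exp (- herglotz_transform f (of_real (1 / r) * circ x) / 2)) \<longlongrightarrow> w) (at_right 1)" .
  then have "((\<lambda>r. 1 / cnj (exp (- herglotz_transform f (of_real (1 / r) * circ x) / 2))) \<longlongrightarrow> 1 / cnj w) (at_right 1)"
    using w(2) by (intro tendsto_intros) auto
  then show ?thesis
  proof (rule Lim_transform_eventually)
    have "\<forall>\<^sub>F r in at_right 1. r \<in> {1<..<2::real}" by (rule eventually_at_right_real) simp
    then show "\<forall>\<^sub>F r in at_right 1. 1 / cnj (exp (- herglotz_transform f (of_real (1 / r) * circ x) / 2)) =
        exp (- herglotz_transform f (of_real r * circ x) / 2)"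
    proof eventually_elim
      case (elim r)
      then have eq: "of_real (1 / r) * circ x = 1 / cnj (of_real r * circ x)"
        by (simp add: cis_cnj field_simps cis_mult)
      have "of_real r * circ x \<noteq> 0" using elim by simp
      then have reflect: "herglotz_transform f (of_real (1 / r) * circ x) =
          - cnj (herglotz_transform f (of_real r * circ x))"
        unfolding eq by (rule herglotz_transform_reflect)
      show ?case
        unfolding reflect exp_cnj by (simp add: exp_minus inverse_eq_divide)
    qed
  qed
qed

section \<open>The circle measure\<close>

lemma circle_measure_eq:
  "circle_measure = completion (distr unit_interval (restrict_space borel (sphere 0 1)) circ)"
  by (simp add: circle_measure_def unit_interval_def)

lemma measurable_circ: "circ \<in> measurable unit_interval (restrict_space borel (sphere 0 1))"
  by (intro measurable_restrict_space2 borel_measurable_unit_interval borel_measurable_continuous_onI continuous_intros) auto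

lemma space_circle_measure: "space circle_measure = sphere 0 1"
  by (simp add: circle_measure_eq space_restrict_space)

lemma borel_measurable_Arg2pi: "Arg2pi \<in> borel_measurable borel"
  by (simp add: borel_measurable_iff_greater open_Arg2pi2pi_gt)

lemma Arg2pi_cis: "0 \<le> \<theta> \<Longrightarrow> \<theta> < 2 * pi \<Longrightarrow> Arg2pi (cis \<theta>) = \<theta>"
  by (rule Arg2pi_unique[of 1]) (auto simp: cis_conv_exp)

lemma cis_Arg2pi: "norm z = 1 \<Longrightarrow> cis (Arg2pi z) = z"
  by (simp add: cis_conv_exp complex_norm_eq_1_exp)

lemma Arg2pi_circ: "t \<in> {0..<1} \<Longrightarrow> Arg2pi (circ t) = 2 * pi * t"
  by (rule Arg2pi_cis) auto

text \<open>P need not be measurable, so a null set containing the exceptions is carried over by the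
  Borel inverse \<zeta> \<mapsto> Arg2pi \<zeta> / (2 pi) of the parametrization.\<close>

lemma AE_circle_measureI:
  assumes "AE t in unit_interval. P (circ t)"
  shows "AE \<zeta> in circle_measure. P \<zeta>"
proof -
  obtain N where N: "{t \<in> space unit_interval. \<not> P (circ t)} \<subseteq> N" "emeasure unit_interval N = 0" "N \<in> sets unit_interval"
    using assms by (rule AE_E)
  let ?S = "restrict_space borel (sphere 0 (1::real)) :: complex measure"
  define Z where "Z = (\<lambda>\<zeta>. Arg2pi \<zeta> / (2 * pi)) -` N \<inter> space ?S"
  have "N \<in> sets borel"
    using N(3) by (auto simp: unit_interval_def sets_restrict_space)
  moreover have "(\<lambda>\<zeta>. Arg2pi \<zeta> / (2 * pi)) \<in> borel_measurable ?S"
    using borel_measurable_Arg2pi by (intro measurable_restrict_space1) simp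
  ultimately have Z: "Z \<in> sets ?S"
    unfolding Z_def by (intro measurable_sets)
  have "circ -` Z \<inter> space unit_interval = N"
    using sets.sets_into_space[OF N(3)] by (auto simp: Z_def Arg2pi_circ space_restrict_space subset_iff)
  then have "emeasure (distr unit_interval ?S circ) Z = 0"
    using N(2) by (simp add: emeasure_distr[OF measurable_circ Z])
  then have "AE \<zeta> in distr unit_interval ?S circ. P \<zeta>"
  proof (rule AE_I[rotated])
    show "{\<zeta> \<in> space (distr unit_interval ?S circ). \<not> P \<zeta>} \<subseteq> Z"
    proof
      fix \<zeta> assume "\<zeta> \<in> {\<zeta> \<in> space (distr unit_interval ?S circ). \<not> P \<zeta>}"
      then have \<zeta>: "norm \<zeta> = 1" "\<not> P \<zeta>" by (auto simp: space_restrict_space)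
      define t where "t = Arg2pi \<zeta> / (2 * pi)"
      have "circ t = \<zeta>" using cis_Arg2pi[OF \<zeta>(1)] by (simp add: t_def)
      moreover have "t \<in> {0..<1}" using Arg2pi_ge_0[of \<zeta>] Arg2pi_lt_2pi[of \<zeta>] by (simp add: t_def)
      ultimately have "t \<in> N" using N(1) \<zeta>(2) by auto
      then show "\<zeta> \<in> Z" using \<zeta>(1) by (simp add: Z_def t_def space_restrict_space)
    qed
  qed (use Z in simp)
  then show ?thesis unfolding circle_measure_eq by (rule AE_completion)
qed

lemma AE_circle_measureD:
  assumes "AE \<zeta> in circle_measure. P \<zeta>"
  shows "AE t in unit_interval. P (circ t)"
  using assms unfolding circle_measure_eq AE_completion_iff by (rule AE_distrD[OF measurable_circ])

lemma AE_circle_measure_neq: "AE \<zeta> in circle_measure. \<zeta> \<noteq> a"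
proof (rule AE_circle_measureI)
  show "AE t in unit_interval. circ t \<noteq> a"
    using AE_unit_interval_neq[of "Arg2pi a / (2 * pi)"] AE_space
    by eventually_elim (auto simp: Arg2pi_circ)
qed

lemma borel_measurable_herglotz_kernel: "herglotz_kernel \<in> borel_measurable borel"
  unfolding herglotz_kernel_def[abs_def] by measurable

text \<open>\<omega> is measurable only for the completed measure, so its logarithm pulled back
  along \<open>circ\<close> may fail to be Borel. A Borel version of the logarithm, equal to it
  almost everywhere, leaves the integral defining \<open>xi\<close> unchanged for each z.\<close>

lemma xi_eq_exp_herglotz_transform:
  assumes "log_dist_integrable \<omega> lam"
  obtains f where "integrable unit_interval f" "AE t in unit_interval. f t = ln \<bar>\<omega> (circ t) - lam\<bar>"
    and "\<And>z. xi \<omega> lam z = exp (- herglotz_transform f z / 2)"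
proof -
  let ?S = "restrict_space borel (sphere 0 (1::real)) :: complex measure"
  let ?D = "distr unit_interval ?S circ"
  define g where "g \<zeta> = ln \<bar>\<omega> \<zeta> - lam\<bar>" for \<zeta>
  have g: "integrable circle_measure g"
    using assms by (simp add: log_dist_integrable_def g_def[abs_def])
  then have gm: "g \<in> borel_measurable (completion ?D)" by (simp add: circle_measure_eq)
  from completion_ex_borel_measurable_real[OF this] obtain h where
    h: "h \<in> borel_measurable ?D" "AE \<zeta> in ?D. g \<zeta> = h \<zeta>" by blast
  have h': "h \<in> borel_measurable ?S" using h(1) by simp
  have hc: "h \<in> borel_measurable (completion ?D)" using h(1) by (rule measurable_completion)
  have AE: "AE \<zeta> in circle_measure. g \<zeta> = h \<zeta>"
    using h(2) unfolding circle_measure_eq by (rule AE_completion)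
  have "integrable circle_measure h"
    using g gm hc AE by (subst integrable_cong_AE[symmetric, of g]) (auto simp: circle_measure_eq)
  then have "integrable ?D h"
    using h(1) by (simp add: circle_measure_eq integrable_completion)
  then have f: "integrable unit_interval (\<lambda>t. h (circ t))"
    by (simp add: integrable_distr_eq[OF measurable_circ h'])
  have "xi \<omega> lam z = exp (- herglotz_transform (\<lambda>t. h (circ t)) z / 2)" for z
  proof -
    have "(\<lambda>\<zeta>. herglotz_kernel (z * cnj \<zeta>)) \<in> borel_measurable borel"
      by (rule measurable_compose[OF _ borel_measurable_herglotz_kernel])
         (intro borel_measurable_continuous_onI continuous_intros)
    then have Hm [measurable]: "(\<lambda>\<zeta>. herglotz_kernel (z * cnj \<zeta>)) \<in> borel_measurable ?S"
      by (rule measurable_restrict_space1)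
    then have "(\<lambda>\<zeta>. herglotz_kernel (z * cnj \<zeta>)) \<in> borel_measurable ?D" by simp
    then have Hc: "(\<lambda>\<zeta>. herglotz_kernel (z * cnj \<zeta>)) \<in> borel_measurable (completion ?D)"
      by (rule measurable_completion)
    have hH: "(\<lambda>\<zeta>. complex_of_real (h \<zeta>) * herglotz_kernel (z * cnj \<zeta>)) \<in> borel_measurable ?S"
      using h' by measurable
    have "(LINT \<zeta>|circle_measure. complex_of_real (ln \<bar>\<omega> \<zeta> - lam\<bar>) * herglotz_kernel (z * cnj \<zeta>)) =
        (LINT \<zeta>|circle_measure. complex_of_real (h \<zeta>) * herglotz_kernel (z * cnj \<zeta>))"
    proof (rule integral_cong_AE)
      note [measurable] = gm[unfolded g_def] hc Hc
      show "(\<lambda>\<zeta>. complex_of_real (ln \<bar>\<omega> \<zeta> - lam\<bar>) * herglotz_kernel (z * cnj \<zeta>)) \<in> borel_measurable circle_measure"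
        "(\<lambda>\<zeta>. complex_of_real (h \<zeta>) * herglotz_kernel (z * cnj \<zeta>)) \<in> borel_measurable circle_measure"
        unfolding circle_measure_eq by measurable
    qed (use AE in eventually_elim, simp add: g_def)
    also have "\<dots> = (LINT \<zeta>|?D. complex_of_real (h \<zeta>) * herglotz_kernel (z * cnj \<zeta>))"
      unfolding circle_measure_eq using hH by (intro integral_completion) simp
    also have "\<dots> = herglotz_transform (\<lambda>t. h (circ t)) z"
      unfolding herglotz_transform_def by (rule integral_distr[OF measurable_circ hH])
    finally show ?thesis by (simp add: xi_def)
  qed
  moreover have "AE t in unit_interval. h (circ t) = ln \<bar>\<omega> (circ t) - lam\<bar>"
    using AE_circle_measureD[OF AE] by eventually_elim (simp add: g_def)
  ultimately show ?thesis using that[of "\<lambda>t. h (circ t)"] f by blast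
qed

lemma xi_radial_limits:
  assumes "log_dist_integrable \<omega> lam"
  shows "AE \<zeta> in circle_measure. \<exists>w. w \<noteq> 0 \<and> has_inner_radial_limit (xi \<omega> lam) \<zeta> w \<and>
           has_outer_radial_limit (xi \<omega> lam) \<zeta> (1 / cnj w) \<and> \<bar>\<omega> \<zeta> - lam\<bar> * (norm w)\<^sup>2 = 1"
proof (rule AE_circle_measureI)
  obtain f where f: "integrable unit_interval f" "AE t in unit_interval. f t = ln \<bar>\<omega> (circ t) - lam\<bar>"
    and xi: "\<And>z. xi \<omega> lam z = exp (- herglotz_transform f z / 2)"
    using xi_eq_exp_herglotz_transform[OF assms] by blast
  have "AE \<zeta> in circle_measure. \<omega> \<zeta> \<noteq> lam"
    using assms by (simp add: log_dist_integrable_def)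
  from AE_circle_measureD[OF this] f(2) exp_herglotz_transform_inner_radial_limit[OF f(1)]
  show "AE t in unit_interval. \<exists>w. w \<noteq> 0 \<and> has_inner_radial_limit (xi \<omega> lam) (circ t) w \<and>
           has_outer_radial_limit (xi \<omega> lam) (circ t) (1 / cnj w) \<and> \<bar>\<omega> (circ t) - lam\<bar> * (norm w)\<^sup>2 = 1"
  proof eventually_elim
    case (elim t)
    then obtain w where w: "((\<lambda>r. exp (- herglotz_transform f (of_real r * circ t) / 2)) \<longlongrightarrow> w) (at_left 1)"
      "(norm w)\<^sup>2 = exp (- f t)" by blast
    have "w \<noteq> 0" using w(2) by auto
    moreover have "\<bar>\<omega> (circ t) - lam\<bar> * (norm w)\<^sup>2 = 1"
      using elim(1,2) w(2) by (simp add: exp_minus)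
    ultimately show ?case
      using w(1) exp_herglotz_transform_outer_radial_limit[OF w(1)]
      by (auto simp: has_inner_radial_limit_def has_outer_radial_limit_def xi)
  qed
qed

lemma mem_open_arc_iff:
  assumes "norm a = 1" "norm \<zeta> = 1"
  shows "\<zeta> \<in> open_arc a b \<longleftrightarrow> 0 < Arg2pi (\<zeta> / a) \<and> Arg2pi (\<zeta> / a) < Arg2pi (b / a)"
proof -
  have a: "a \<noteq> 0" using assms by auto
  show ?thesis
  proof
    assume "\<zeta> \<in> open_arc a b"
    then obtain \<theta> where \<theta>: "\<zeta> = a * cis \<theta>" "0 < \<theta>" "\<theta> < Arg2pi (b / a)" by (auto simp: open_arc_def)
    have "Arg2pi (\<zeta> / a) = \<theta>"
      using \<theta> a Arg2pi_lt_2pi[of "b / a"] by (simp add: Arg2pi_cis)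
    with \<theta> show "0 < Arg2pi (\<zeta> / a) \<and> Arg2pi (\<zeta> / a) < Arg2pi (b / a)" by simp
  next
    assume "0 < Arg2pi (\<zeta> / a) \<and> Arg2pi (\<zeta> / a) < Arg2pi (b / a)"
    moreover have "\<zeta> = a * cis (Arg2pi (\<zeta> / a))"
      using assms a by (simp add: cis_Arg2pi norm_divide)
    ultimately show "\<zeta> \<in> open_arc a b" unfolding open_arc_def by blast
  qed
qed

lemma measure_unit_interval: "A \<subseteq> {0..<1} \<Longrightarrow> measure unit_interval A = measure lborel A"
  unfolding unit_interval_def by (rule measure_restrict_space) auto

lemma
  assumes a: "norm a = 1"
  shows sets_open_arc: "open_arc a b \<in> sets (restrict_space borel (sphere 0 1))"
    and measure_open_arc: "measure circle_measure (open_arc a b) = Arg2pi (b / a) / (2 * pi)"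
proof -
  let ?S = "restrict_space borel (sphere 0 (1::real)) :: complex measure"
  have "open_arc a b \<subseteq> sphere 0 1" using a by (auto simp: open_arc_def norm_mult)
  then have arc_eq: "open_arc a b = (\<lambda>\<zeta>. Arg2pi (\<zeta> / a)) -` {0<..<Arg2pi (b / a)} \<inter> space ?S"
    using mem_open_arc_iff[OF a] by (auto simp: space_restrict_space)
  have arg: "(\<lambda>\<zeta>. Arg2pi (\<zeta> / a)) \<in> borel_measurable ?S"
    by (intro measurable_restrict_space1 measurable_compose[OF _ borel_measurable_Arg2pi]) measurable
  show arc: "open_arc a b \<in> sets ?S"
    unfolding arc_eq by (rule measurable_sets[OF arg]) simp
  define s where "s = Arg2pi a / (2 * pi)"
  define L where "L = Arg2pi (b / a) / (2 * pi)"
  have s: "circ s = a" "0 \<le> s" "s < 1"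
    using cis_Arg2pi[OF a] Arg2pi_ge_0[of a] Arg2pi_lt_2pi[of a] by (auto simp: s_def)
  have L: "0 \<le> L" "L < 1" "Arg2pi (b / a) = 2 * pi * L"
    using Arg2pi_ge_0[of "b / a"] Arg2pi_lt_2pi[of "b / a"] by (auto simp: L_def)
  \<comment> \<open>The second alternative is the part of the arc that runs past parameter 1 and
    re-enters at 0.\<close>
  have mem: "circ t \<in> open_arc a b \<longleftrightarrow> (s < t \<and> t < s + L) \<or> t < s + L - 1" if t: "0 \<le> t" "t < 1" for t
  proof -
    have q: "circ t / a = circ (t - s)"
      by (simp add: s(1)[symmetric] cis_divide right_diff_distrib)
    show ?thesis
    proof (cases "s \<le> t")
      case True
      then have "Arg2pi (circ t / a) = 2 * pi * (t - s)"
        unfolding q using t s by (intro Arg2pi_circ) auto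
      then show ?thesis using True L t by (subst mem_open_arc_iff[OF a]) (auto simp: zero_less_mult_iff)
    next
      case False
      then have "Arg2pi (circ t / a) = 2 * pi * (t - s + 1)"
        unfolding q circ_period[of "t - s", symmetric] using t s by (intro Arg2pi_circ) auto
      then show ?thesis using False L t s by (subst mem_open_arc_iff[OF a]) (auto simp: zero_less_mult_iff)
    qed
  qed
  have "measure circle_measure (open_arc a b) = measure (distr unit_interval ?S circ) (open_arc a b)"
    unfolding circle_measure_eq using arc by (intro measure_completion) simp
  also have "\<dots> = measure unit_interval (circ -` open_arc a b \<inter> space unit_interval)"
    by (rule measure_distr[OF measurable_circ arc])
  also have "\<dots> = L"
  proof (cases "s + L \<le> 1")
    case True
    then have "circ -` open_arc a b \<inter> space unit_interval = {s<..<s+L}"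
      using mem s L by auto
    then show ?thesis using True s L by (subst measure_unit_interval) auto
  next
    case False
    then have "circ -` open_arc a b \<inter> space unit_interval = {s<..<1} \<union> {0..<s+L-1}"
      using mem s L by auto
    moreover have "measure lborel ({s<..<1} \<union> {0..<s+L-1}) = measure lborel {s<..<1} + measure lborel {0..<s+L-1}"
      using False s L by (intro measure_Union) auto
    ultimately show ?thesis using False s L by (subst measure_unit_interval) auto
  qed
  finally show "measure circle_measure (open_arc a b) = Arg2pi (b / a) / (2 * pi)" by (simp add: L_def)
qed

section \<open>Branch factors of the arcs\<close>

lemma Re_one_minus_unit_pos:
  assumes "norm w = 1" "w \<noteq> 1"
  shows "0 < Re (1 - w)"
proof -
  have sq: "(Re w)\<^sup>2 + (Im w)\<^sup>2 = 1" using assms(1) by (simp flip: cmod_power2)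
  have "Re w \<le> 1" using complex_Re_le_cmod[of w] assms(1) by simp
  moreover have "Re w \<noteq> 1"
  proof
    assume "Re w = 1"
    with sq have "Im w = 0" by simp
    with \<open>Re w = 1\<close> assms(2) show False by (simp add: complex_eq_iff)
  qed
  ultimately show ?thesis by simp
qed

text \<open>With s = A^(1/2) one has A = s^2 and |A| = s cnj s, so conjugation costs a unimodular
  factor. Positivity of Re A keeps A off the branch cut, where principal powers need not commute
  with conjugation.\<close>

lemma cnj_powr_half:
  assumes "0 < Re A"
  shows "cnj A powr (1 / 2) = cnj A / of_real (norm A) * A powr (1 / 2)"
    and "cnj A powr (- (1 / 2)) = A / of_real (norm A) * A powr (- (1 / 2))"
proof -
  define s where "s = A powr (1 / 2)"
  have A: "A \<noteq> 0" using assms by auto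
  then have s: "s \<noteq> 0" by (simp add: s_def)
  have ss: "s * s = A" using A by (simp add: s_def flip: powr_add)
  then have nA: "of_real (norm A) = s * cnj s"
    by (metis complex_norm_square norm_mult power2_eq_square)
  have c: "cnj A powr (1 / 2) = cnj s"
    using cnj_powr[of A "1/2"] assms by (simp add: s_def)
  show "cnj A powr (1 / 2) = cnj A / of_real (norm A) * A powr (1 / 2)"
    unfolding c nA s_def[symmetric] using s by (simp add: field_simps flip: ss)
  have "cnj A powr (- (1 / 2)) = inverse (cnj s)" "A powr (- (1 / 2)) = inverse s"
    by (simp_all only: powr_minus c s_def)
  then show "cnj A powr (- (1 / 2)) = A / of_real (norm A) * A powr (- (1 / 2))"
    unfolding nA using s by (simp add: field_simps flip: ss)
qed

lemma one_minus_cis: "1 - cis x = - 2 * \<i> * of_real (sin (x / 2)) * cis (x / 2)"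
proof -
  define y where "y = x / 2"
  have x: "x = 2 * y" by (simp add: y_def)
  have "cos x = 1 - 2 * (sin y)\<^sup>2" unfolding x by (rule cos_double_sin)
  moreover have "sin x = 2 * sin y * cos y" unfolding x by (rule sin_double)
  ultimately show ?thesis
    unfolding y_def[symmetric] by (simp add: complex_eq_iff power2_eq_square)
qed

text \<open>On the circle \<alpha> / \<zeta> is the conjugate of \<zeta> cnj \<alpha>, so the outer
  bases are conjugates of the inner ones A and B, and the quotient of the factors is (A / |A|) (cnj
  B / |B|). With angles \<theta> of \<zeta> and \<phi> of \<beta> measured from \<alpha>, the
  half-angle formula gives A / |A| = - i cis (\<theta> / 2) and B / |B| = - i \<sigma> cis
  ((\<theta> - \<phi>) / 2), where \<sigma> is the sign of sin ((\<theta> - \<phi>) / 2), negative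
  exactly for \<theta> < \<phi>, that is, on the arc.\<close>

lemma arc_branch_jump:
  fixes \<alpha> \<beta> \<zeta> :: complex
  assumes "norm \<alpha> = 1" "norm \<beta> = 1" "norm \<zeta> = 1" and neq: "\<zeta> \<noteq> \<alpha>" "\<zeta> \<noteq> \<beta>"
  shows "(1 - \<alpha> / \<zeta>) powr (- (1 / 2)) * (1 - \<beta> / \<zeta>) powr (1 / 2) =
    (if \<zeta> \<in> open_arc \<alpha> \<beta> then - 1 else 1) * cis (Arg2pi (\<beta> / \<alpha>) / 2) *
      ((1 - \<zeta> * cnj \<alpha>) powr (- (1 / 2)) * (1 - \<zeta> * cnj \<beta>) powr (1 / 2))"
proof -
  define \<theta> where "\<theta> = Arg2pi (\<zeta> / \<alpha>)"
  define \<phi> where "\<phi> = Arg2pi (\<beta> / \<alpha>)"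
  define A where "A = 1 - \<zeta> * cnj \<alpha>"
  define B where "B = 1 - \<zeta> * cnj \<beta>"
  have cnj: "cnj \<alpha> = 1 / \<alpha>" "cnj \<beta> = 1 / \<beta>" "cnj \<zeta> = 1 / \<zeta>"
    using assms(1-3) by (auto simp: complex_div_cnj[of 1])
  have nz: "\<alpha> \<noteq> 0" "\<beta> \<noteq> 0" "\<zeta> \<noteq> 0" using assms by auto
  have conj: "1 - \<alpha> / \<zeta> = cnj A" "1 - \<beta> / \<zeta> = cnj B"
    using nz by (auto simp: A_def B_def cnj)
  have pos: "0 < Re A" "0 < Re B"
    unfolding A_def B_def cnj using assms nz
    by (intro Re_one_minus_unit_pos; simp add: norm_mult norm_divide)+
  have \<theta>: "cis \<theta> = \<zeta> / \<alpha>" and \<phi>: "cis \<phi> = \<beta> / \<alpha>"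
    using assms by (auto simp: \<theta>_def \<phi>_def cis_Arg2pi norm_divide)
  have rng: "0 \<le> \<theta>" "\<theta> < 2 * pi" "0 \<le> \<phi>" "\<phi> < 2 * pi"
    by (auto simp: \<theta>_def \<phi>_def Arg2pi_ge_0 Arg2pi_lt_2pi)
  have "\<theta> \<noteq> 0" using \<theta> neq(1) nz by auto
  then have \<theta>0: "0 < \<theta>" using rng by simp
  have "\<theta> \<noteq> \<phi>" using \<theta> \<phi> neq(2) nz by auto
  have A: "A = - 2 * \<i> * of_real (sin (\<theta> / 2)) * cis (\<theta> / 2)"
    unfolding one_minus_cis[symmetric] \<theta> by (simp add: A_def cnj)
  have "cis (\<theta> - \<phi>) = \<zeta> / \<beta>" using \<theta> \<phi> nz by (simp flip: cis_divide)
  then have B: "B = - 2 * \<i> * of_real (sin ((\<theta> - \<phi>) / 2)) * cis ((\<theta> - \<phi>) / 2)"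
    unfolding one_minus_cis[symmetric] by (simp add: B_def cnj)
  have sA: "0 < sin (\<theta> / 2)" using \<theta>0 rng by (intro sin_gt_zero) auto
  define \<sigma> where "\<sigma> = (if \<zeta> \<in> open_arc \<alpha> \<beta> then - 1 else 1 :: real)"
  have arc: "\<zeta> \<in> open_arc \<alpha> \<beta> \<longleftrightarrow> \<theta> < \<phi>"
    using mem_open_arc_iff[OF assms(1,3), of \<beta>] \<theta>0 by (simp add: \<theta>_def \<phi>_def)
  have sB: "sin ((\<theta> - \<phi>) / 2) = \<sigma> * \<bar>sin ((\<theta> - \<phi>) / 2)\<bar>" "sin ((\<theta> - \<phi>) / 2) \<noteq> 0"
  proof -
    have "0 < sin ((\<theta> - \<phi>) / 2)" if "\<not> \<theta> < \<phi>"
      using that \<open>\<theta> \<noteq> \<phi>\<close> rng by (intro sin_gt_zero) auto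
    moreover have "0 < sin ((\<phi> - \<theta>) / 2)" if "\<theta> < \<phi>"
      using that rng by (intro sin_gt_zero) auto
    moreover have "sin ((\<theta> - \<phi>) / 2) = - sin ((\<phi> - \<theta>) / 2)"
      by (simp flip: sin_minus add: minus_divide_left)
    ultimately show "sin ((\<theta> - \<phi>) / 2) = \<sigma> * \<bar>sin ((\<theta> - \<phi>) / 2)\<bar>" "sin ((\<theta> - \<phi>) / 2) \<noteq> 0"
      by (cases "\<theta> < \<phi>"; force simp: \<sigma>_def arc)+
  qed
  define p q where "p = sin (\<theta> / 2)" and "q = \<bar>sin ((\<theta> - \<phi>) / 2)\<bar>"
  have pq: "0 < p" "0 < q" using sA sB(2) by (auto simp: p_def q_def)
  have A': "A = - 2 * \<i> * of_real p * cis (\<theta> / 2)" by (simp add: A p_def)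
  have B': "B = - 2 * \<i> * of_real (\<sigma> * q) * cis ((\<theta> - \<phi>) / 2)"
    unfolding B q_def sB(1)[symmetric] by simp
  have \<sigma>: "\<bar>\<sigma>\<bar> = 1" by (simp add: \<sigma>_def)
  have n: "norm A = 2 * p" "norm B = 2 * q"
    unfolding A' B' using pq \<sigma> by (simp_all add: norm_mult abs_mult)
  have "cis (\<theta> / 2) * cnj (cis ((\<theta> - \<phi>) / 2)) = cis (\<phi> / 2)"
    by (simp add: cis_cnj cis_mult diff_divide_distrib)
  moreover have "A / of_real (norm A) * (cnj B / of_real (norm B)) =
      of_real \<sigma> * (cis (\<theta> / 2) * cnj (cis ((\<theta> - \<phi>) / 2)))"
    unfolding n unfolding A' B' using pq by (simp add: field_simps)
  ultimately have key: "A / of_real (norm A) * (cnj B / of_real (norm B)) = of_real \<sigma> * cis (\<phi> / 2)" by simp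
  have "cnj A powr (- (1 / 2)) * cnj B powr (1 / 2) =
      A / of_real (norm A) * (cnj B / of_real (norm B)) * (A powr (- (1 / 2)) * B powr (1 / 2))"
    unfolding cnj_powr_half(2)[OF pos(1)] cnj_powr_half(1)[OF pos(2)] by (simp only: mult_ac)
  then show ?thesis
    unfolding key conj A_def[symmetric] B_def[symmetric] by (simp add: \<sigma>_def \<phi>_def)
qed

section \<open>Combining the arcs\<close>

lemma prob_space_circle_measure: "prob_space circle_measure"
  unfolding circle_measure_eq
  by (intro prob_space.prob_space_completion unit_interval.prob_space_distr measurable_circ)

lemma measure_UN_open_arc:
  assumes \<alpha>: "\<And>l. l \<in> I \<Longrightarrow> norm (\<alpha> l) = 1" and I: "finite I"
    and disj: "disjoint_family_on (\<lambda>l. open_arc (\<alpha> l) (\<beta> l)) I"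
  shows "(\<Union>l\<in>I. open_arc (\<alpha> l) (\<beta> l)) \<in> sets circle_measure"
    and "measure circle_measure (\<Union>l\<in>I. open_arc (\<alpha> l) (\<beta> l)) = (\<Sum>l\<in>I. Arg2pi (\<beta> l / \<alpha> l) / (2 * pi))"
proof -
  interpret prob_space circle_measure by (rule prob_space_circle_measure)
  have sets: "open_arc (\<alpha> l) (\<beta> l) \<in> sets circle_measure" if "l \<in> I" for l
    unfolding circle_measure_eq using sets_open_arc[OF \<alpha>[OF that]] by (intro sets_completionI_sets) simp
  then show "(\<Union>l\<in>I. open_arc (\<alpha> l) (\<beta> l)) \<in> sets circle_measure"
    using I by auto
  have "measure circle_measure (\<Union>l\<in>I. open_arc (\<alpha> l) (\<beta> l)) = (\<Sum>l\<in>I. measure circle_measure (open_arc (\<alpha> l) (\<beta> l)))"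
    using sets by (intro finite_measure_finite_Union I disj) auto
  also have "\<dots> = (\<Sum>l\<in>I. Arg2pi (\<beta> l / \<alpha> l) / (2 * pi))"
    by (intro sum.cong refl measure_open_arc \<alpha>)
  finally show "measure circle_measure (\<Union>l\<in>I. open_arc (\<alpha> l) (\<beta> l)) = (\<Sum>l\<in>I. Arg2pi (\<beta> l / \<alpha> l) / (2 * pi))" .
qed

text \<open>By disjointness at most one factor differs from 1.\<close>

lemma prod_sign_disjoint:
  assumes "finite I" "disjoint_family_on A I"
  shows "(\<Prod>l\<in>I. if x \<in> A l then - 1 else 1 :: 'a :: comm_ring_1) = (if x \<in> (\<Union>l\<in>I. A l) then - 1 else 1)"
proof (cases "x \<in> (\<Union>l\<in>I. A l)")
  case True
  then obtain k where k: "k \<in> I" "x \<in> A k" by blast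
  have "x \<notin> A l" if "l \<in> I - {k}" for l
    using assms(2) k that by (auto simp: disjoint_family_on_def)
  then have "(\<Prod>l\<in>I - {k}. if x \<in> A l then - 1 else 1 :: 'a) = 1"
    by (intro prod.neutral) auto
  then show ?thesis using True k by (simp add: prod.remove[OF assms(1) k(1)])
qed auto

lemma prod_cis: "(\<Prod>l\<in>I. cis (f l)) = cis (\<Sum>l\<in>I. f l)"
  by (induction I rule: infinite_finite_induct) (auto simp: cis_mult)

lemma one_minus_unit_notin_nonpos_Reals:
  fixes w :: complex
  assumes "norm w = 1" "w \<noteq> 1"
  shows "1 - w \<notin> \<real>\<^sub>\<le>\<^sub>0"
  using Re_one_minus_unit_pos[OF assms] by (auto simp: complex_nonpos_Reals_iff)

text \<open>Away from the endpoints of the arcs every base has positive real part at \<zeta>, so the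
  principal powers are continuous there and \<open>xi\<close> is the only factor whose limit must be
  supplied.\<close>

lemma phi_radial_limits:
  assumes unit: "\<And>l. l \<in> {1..m} \<Longrightarrow> norm (\<alpha> l) = 1 \<and> norm (\<beta> l) = 1" and \<zeta>: "norm \<zeta> = 1"
    and neq: "\<And>l. l \<in> {1..m} \<Longrightarrow> \<zeta> \<noteq> \<alpha> l \<and> \<zeta> \<noteq> \<beta> l" and j: "j \<in> {1..m}"
  shows "has_inner_radial_limit (xi \<omega> lam) \<zeta> w \<Longrightarrow> has_inner_radial_limit (phi \<omega> lam m \<alpha> \<beta> j) \<zeta>
      (of_real (rho m \<alpha> \<beta> j) * w * inverse (1 - \<zeta> * cnj (\<beta> j)) *
        (\<Prod>l = 1..m. (1 - \<zeta> * cnj (\<alpha> l)) powr (- (1 / 2)) * (1 - \<zeta> * cnj (\<beta> l)) powr (1 / 2)))"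
    and "has_outer_radial_limit (xi \<omega> lam) \<zeta> w' \<Longrightarrow> has_outer_radial_limit (phi_ext \<omega> lam m \<alpha> \<beta> j) \<zeta>
      (of_real (rho m \<alpha> \<beta> j) *
        exp (- (pi * \<i> * complex_of_real (measure circle_measure (sublevel \<omega> lam)))) *
        w' * inverse (1 - \<zeta> * cnj (\<beta> j)) *
        (\<Prod>l = 1..m. (1 - \<alpha> l / \<zeta>) powr (- (1 / 2)) * (1 - \<beta> l / \<zeta>) powr (1 / 2)))"
proof -
  have \<zeta>0: "\<zeta> \<noteq> 0" using \<zeta> by auto
  have cnj_neq: "norm (\<zeta> * cnj c) = 1" "\<zeta> * cnj c \<noteq> 1" "norm (c / \<zeta>) = 1" "c / \<zeta> \<noteq> 1"
    if "norm c = 1" "\<zeta> \<noteq> c" for c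
  proof -
    have "cnj c = 1 / c" "c \<noteq> 0" using that by (auto simp: complex_div_cnj[of 1])
    then show "norm (\<zeta> * cnj c) = 1" "\<zeta> * cnj c \<noteq> 1" "norm (c / \<zeta>) = 1" "c / \<zeta> \<noteq> 1"
      using that \<zeta> \<zeta>0 by (auto simp: norm_mult norm_divide)
  qed
  have notin: "1 - \<zeta> * cnj (\<alpha> l) \<notin> \<real>\<^sub>\<le>\<^sub>0" "1 - \<zeta> * cnj (\<beta> l) \<notin> \<real>\<^sub>\<le>\<^sub>0"
    "1 - \<alpha> l / \<zeta> \<notin> \<real>\<^sub>\<le>\<^sub>0" "1 - \<beta> l / \<zeta> \<notin> \<real>\<^sub>\<le>\<^sub>0" if "l \<in> {1..m}" for l
    using unit[OF that] neq[OF that]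
    by (intro one_minus_unit_notin_nonpos_Reals cnj_neq; simp)+
  have \<beta>j: "1 - \<zeta> * cnj (\<beta> j) \<noteq> 0" using notin(2)[OF j] by auto
  \<comment> \<open>A general S serves the inner and the outer limit at once.\<close>
  have r: "((\<lambda>r. of_real r * \<zeta>) \<longlongrightarrow> \<zeta>) (at 1 within S)" for S :: "real set"
  proof -
    have "((\<lambda>r. of_real r * \<zeta>) \<longlongrightarrow> of_real 1 * \<zeta>) (at 1 within S)"
      by (intro tendsto_intros)
    then show ?thesis by simp
  qed
  show "has_inner_radial_limit (phi \<omega> lam m \<alpha> \<beta> j) \<zeta>
      (of_real (rho m \<alpha> \<beta> j) * w * inverse (1 - \<zeta> * cnj (\<beta> j)) *
        (\<Prod>l = 1..m. (1 - \<zeta> * cnj (\<alpha> l)) powr (- (1 / 2)) * (1 - \<zeta> * cnj (\<beta> l)) powr (1 / 2)))"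
    if "has_inner_radial_limit (xi \<omega> lam) \<zeta> w"
    using that \<beta>j unfolding has_inner_radial_limit_def phi_def
    by (intro tendsto_mult tendsto_inverse tendsto_prod tendsto_powr_complex tendsto_diff tendsto_const r notin)
  show "has_outer_radial_limit (phi_ext \<omega> lam m \<alpha> \<beta> j) \<zeta>
      (of_real (rho m \<alpha> \<beta> j) *
        exp (- (pi * \<i> * complex_of_real (measure circle_measure (sublevel \<omega> lam)))) *
        w' * inverse (1 - \<zeta> * cnj (\<beta> j)) *
        (\<Prod>l = 1..m. (1 - \<alpha> l / \<zeta>) powr (- (1 / 2)) * (1 - \<beta> l / \<zeta>) powr (1 / 2)))"
    if "has_outer_radial_limit (xi \<omega> lam) \<zeta> w'"
    using that \<beta>j \<zeta>0 unfolding has_outer_radial_limit_def phi_ext_def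
    by (intro tendsto_mult tendsto_inverse tendsto_prod tendsto_powr_complex tendsto_diff tendsto_divide tendsto_const r notin)
qed

theorem theorem5p5:
  fixes \<omega> :: "complex \<Rightarrow> real" and lam :: real and m :: nat and \<alpha> \<beta> :: "nat \<Rightarrow> complex"
  assumes "integrable circle_measure \<omega>"
    and "\<not> (\<exists>c. AE \<zeta> in circle_measure. \<omega> \<zeta> = c)"
    and "essinf circle_measure (\<lambda>\<zeta>. ereal (\<omega> \<zeta>)) > - \<infinity>"
    and "essinf circle_measure (\<lambda>\<zeta>. ereal (\<omega> \<zeta>)) < ereal lam"
    and "ereal lam < esssup circle_measure (\<lambda>\<zeta>. ereal (\<omega> \<zeta>))"
    and "log_dist_integrable \<omega> lam"
    and "\<And>j. j \<in> {1..m} \<Longrightarrow> \<alpha> j \<in> sphere 0 1 \<and> \<beta> j \<in> sphere 0 1 \<and> \<alpha> j \<noteq> \<beta> j"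
    and "disjoint_family_on (\<lambda>j. closure (open_arc (\<alpha> j) (\<beta> j))) {1..m}"
    and "AE \<zeta> in circle_measure.
           \<zeta> \<in> sublevel \<omega> lam \<longleftrightarrow> \<zeta> \<in> (\<Union>j\<in>{1..m}. open_arc (\<alpha> j) (\<beta> j))"
  shows "\<forall>j\<in>{1..m}. AE \<zeta> in circle_measure.
           \<exists>u v. has_inner_radial_limit (phi \<omega> lam m \<alpha> \<beta> j) \<zeta> u \<and>
                 has_outer_radial_limit (phi_ext \<omega> lam m \<alpha> \<beta> j) \<zeta> v \<and>
                 complex_of_real (\<omega> \<zeta> - lam) * u = v"
proof
  fix j assume j: "j \<in> {1..m}"
  let ?arc = "\<lambda>l. open_arc (\<alpha> l) (\<beta> l)"
  define \<phi> where "\<phi> l = Arg2pi (\<beta> l / \<alpha> l)" for l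
  define \<mu> where "\<mu> = measure circle_measure (sublevel \<omega> lam)"
  have unit: "norm (\<alpha> l) = 1 \<and> norm (\<beta> l) = 1" if "l \<in> {1..m}" for l
    using assms(7)[OF that] by simp
  have disj: "disjoint_family_on ?arc {1..m}"
    using assms(8) closure_subset unfolding disjoint_family_on_def by blast
  have meas: "(\<Union>l\<in>{1..m}. ?arc l) \<in> sets circle_measure"
    and arcs: "measure circle_measure (\<Union>l\<in>{1..m}. ?arc l) = (\<Sum>l = 1..m. \<phi> l / (2 * pi))"
    unfolding \<phi>_def by (rule measure_UN_open_arc; use unit disj in simp)+
  have "sublevel \<omega> lam = {\<zeta> \<in> space circle_measure. \<omega> \<zeta> < lam}"
    by (simp add: sublevel_def space_circle_measure)
  moreover have "\<omega> \<in> borel_measurable circle_measure" using assms(1) by simp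
  ultimately have "sublevel \<omega> lam \<in> sets circle_measure" by simp
  from measure_eq_AE[OF assms(9) this meas] have \<mu>: "\<mu> = (\<Sum>l = 1..m. \<phi> l / (2 * pi))"
    unfolding \<mu>_def arcs .
  \<comment> \<open>Half the opening angle of an arc is pi times its measure, so the phases of all
    arcs multiply to exp (i pi \<mu>), which the prefactor of \<open>phi_ext\<close>
    cancels.\<close>
  have phase: "exp (- (pi * \<i> * complex_of_real \<mu>)) * (\<Prod>l = 1..m. cis (\<phi> l / 2)) = 1"
  proof -
    have "pi * \<mu> = (\<Sum>l = 1..m. \<phi> l / 2)"
      unfolding \<mu> sum_distrib_left by (intro sum.cong) auto
    then have "(\<Prod>l = 1..m. cis (\<phi> l / 2)) = cis (pi * \<mu>)"
      by (simp only: prod_cis)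
    then show ?thesis
      by (simp only:) (simp add: cis_conv_exp mult_ac flip: exp_add)
  qed
  have ne: "AE \<zeta> in circle_measure. \<forall>l\<in>{1..m}. \<zeta> \<noteq> \<alpha> l \<and> \<zeta> \<noteq> \<beta> l"
  proof (rule AE_ball_countable[THEN iffD2])
    show "\<forall>l\<in>{1..m}. AE \<zeta> in circle_measure. \<zeta> \<noteq> \<alpha> l \<and> \<zeta> \<noteq> \<beta> l"
      using AE_circle_measure_neq by auto
  qed simp
  have "AE \<zeta> in circle_measure. \<omega> \<zeta> \<noteq> lam"
    using assms(6) by (simp add: log_dist_integrable_def)
  from this AE_space ne xi_radial_limits[OF assms(6)] assms(9)
  show "AE \<zeta> in circle_measure.
           \<exists>u v. has_inner_radial_limit (phi \<omega> lam m \<alpha> \<beta> j) \<zeta> u \<and>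
                 has_outer_radial_limit (phi_ext \<omega> lam m \<alpha> \<beta> j) \<zeta> v \<and>
                 complex_of_real (\<omega> \<zeta> - lam) * u = v"
  proof eventually_elim
    case (elim \<zeta>)
    have \<zeta>: "norm \<zeta> = 1" using elim(2) by (simp add: space_circle_measure)
    have neq: "\<zeta> \<noteq> \<alpha> l \<and> \<zeta> \<noteq> \<beta> l" if "l \<in> {1..m}" for l using elim(3) that by blast
    obtain w where w: "w \<noteq> 0" "has_inner_radial_limit (xi \<omega> lam) \<zeta> w"
        "has_outer_radial_limit (xi \<omega> lam) \<zeta> (1 / cnj w)" "\<bar>\<omega> \<zeta> - lam\<bar> * (norm w)\<^sup>2 = 1"
      using elim(4) by blast
    define E where "E = (\<Prod>l = 1..m. (1 - \<zeta> * cnj (\<alpha> l)) powr (- (1 / 2)) * (1 - \<zeta> * cnj (\<beta> l)) powr (1 / 2))"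
    define E' where "E' = (\<Prod>l = 1..m. (1 - \<alpha> l / \<zeta>) powr (- (1 / 2)) * (1 - \<beta> l / \<zeta>) powr (1 / 2))"
    define \<sigma> :: real where "\<sigma> = (if \<omega> \<zeta> < lam then - 1 else 1)"
    have "E' = (\<Prod>l = 1..m. if \<zeta> \<in> ?arc l then - 1 else 1) * (\<Prod>l = 1..m. cis (\<phi> l / 2)) * E"
      unfolding E'_def E_def \<phi>_def prod.distrib[symmetric]
      by (intro prod.cong refl arc_branch_jump) (use unit \<zeta> neq in auto)
    \<comment> \<open>Lying on some arc is, at this \<zeta>, the same as \<omega> \<zeta> < lam, so
      the jumps multiply to the sign of \<omega> \<zeta> - lam.\<close>
    also have "(\<Prod>l = 1..m. if \<zeta> \<in> ?arc l then - 1 else 1 :: complex) = of_real \<sigma>"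
      unfolding prod_sign_disjoint[OF finite_atLeastAtMost disj] using elim(5) \<zeta>
      by (simp add: \<sigma>_def sublevel_def)
    finally have "exp (- (pi * \<i> * complex_of_real \<mu>)) * E' =
        of_real \<sigma> * (exp (- (pi * \<i> * complex_of_real \<mu>)) * (\<Prod>l = 1..m. cis (\<phi> l / 2))) * E"
      by (simp only: mult_ac)
    then have E': "exp (- (pi * \<i> * complex_of_real \<mu>)) * E' = of_real \<sigma> * E"
      by (simp only: phase mult_1_right)
    have "of_real (\<bar>\<omega> \<zeta> - lam\<bar>) * (w * cnj w) = 1"
      using w(4) by (simp flip: complex_norm_square of_real_mult of_real_power)
    then have "1 / cnj w = of_real (\<bar>\<omega> \<zeta> - lam\<bar>) * w"
      using w(1) by (simp add: field_simps)
    \<comment> \<open>The absolute value is \<sigma> (\<omega> \<zeta> - lam), and \<sigma>^2 =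
      1.\<close>
    then have jump: "of_real (\<omega> \<zeta> - lam) * w = of_real \<sigma> * (1 / cnj w)"
      by (simp add: \<sigma>_def)
    define u where "u = of_real (rho m \<alpha> \<beta> j) * w * inverse (1 - \<zeta> * cnj (\<beta> j)) * E"
    define v where "v = of_real (rho m \<alpha> \<beta> j) * exp (- (pi * \<i> * complex_of_real \<mu>)) * (1 / cnj w) *
        inverse (1 - \<zeta> * cnj (\<beta> j)) * E'"
    have "v = of_real (rho m \<alpha> \<beta> j) * (1 / cnj w) * inverse (1 - \<zeta> * cnj (\<beta> j)) *
        (exp (- (pi * \<i> * complex_of_real \<mu>)) * E')"
      unfolding v_def by (simp only: mult_ac)
    also have "\<dots> = of_real (rho m \<alpha> \<beta> j) * (of_real \<sigma> * (1 / cnj w)) * inverse (1 - \<zeta> * cnj (\<beta> j)) * E"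
      unfolding E' by (simp only: mult_ac)
    also have "\<dots> = of_real (\<omega> \<zeta> - lam) * u"
      unfolding jump[symmetric] u_def by (simp only: mult_ac)
    finally have "complex_of_real (\<omega> \<zeta> - lam) * u = v" by simp
    moreover have "has_inner_radial_limit (phi \<omega> lam m \<alpha> \<beta> j) \<zeta> u"
      unfolding u_def E_def by (rule phi_radial_limits(1)[OF unit \<zeta> neq j w(2)])
    moreover have "has_outer_radial_limit (phi_ext \<omega> lam m \<alpha> \<beta> j) \<zeta> v"
      unfolding v_def E'_def \<mu>_def by (rule phi_radial_limits(2)[OF unit \<zeta> neq j w(3)])
    ultimately show ?case by blast
  qed
qed

end
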